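(* Let $R$ be an integral domain and let $A$ be a cellular $R$-algebra with cellular basis $\{C_{S,T}^\lambda \mid S,T\in M(\lambda),\ \lambda\in\Lambda\}$. Let $K$ be the field of fractions of $R$ and $A_K=A\otimes_R K$. Suppose that $A$ is equipped with a family of Jucys-Murphy elements $L_1,\ldots,L_m$ which satisfies the separation condition, and that every symmetric polynomial in $L_1,\ldots,L_m$ (with coefficients in $K$) belongs to the center $Z(A_K)$ of $A_K$. Then the following are equivalent. (1) The center of $A_K$ consists of all symmetric polynomials in the Jucys-Murphy elements, i.e. $Z(A_K)=\{p(L_1,\ldots,L_m)\mid p\in K[X_1,\ldots,X_m] \text{ symmetric}\}$. (2) For any $\lambda,\mu\in\Lambda$ with $\lambda\neq\mu$, the family $\{c_\lambda(i)\mid 1\le i\le m\}$ cannot be obtained from the family $\{c_\mu(i)\mid 1\le i\le m\}$ by permutations, i.e. there is no permutation $\sigma$ of $\{1,\ldots,m\}$ with $c_\lambda(i)=c_\mu(\sigma(i))$ for all $i$.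
   Context: Cellular algebra (Graham-Lehrer): an associative unital $R$-algebra $A$ with cell datum $(\Lambda,M,C,i)$ such that: (C1) $\Lambda$ is a finite poset; to each $\lambda\in\Lambda$ is associated a (non-empty) finite set $M(\lambda)$; $A$ has an $R$-basis $\{C_{S,T}^\lambda\mid S,T\in M(\lambda),\lambda\in\Lambda\}$. (C2) The map $i$ is an $R$-linear anti-automorphism of $A$ with $i^2=\mathrm{id}$ sending $C_{S,T}^\lambda$ to $C_{T,S}^\lambda$. (C3) For $\lambda\in\Lambda$, $S,T\in M(\lambda)$ and $a\in A$, $aC_{S,T}^\lambda\equiv\sum_{S'\in M(\lambda)}r_a(S',S)C_{S',T}^\lambda \pmod{A(<\lambda)}$, where $r_a(S',S)\in R$ is independent of $T$ and $A(<\lambda)$ is the $R$-submodule of $A$ generated by $\{C_{S'',T''}^\mu\mid S'',T''\in M(\mu),\ \mu<\lambda\}$. Each $M(\lambda)$ is assumed to be a poset with an order $\le_\lambda$. The disjoint union $M(\Lambda)=\bigsqcup_{\lambda\in\Lambda}M(\lambda)$ is a poset with the order: $S\le T$ iff $S\le_\lambda T$ when $S,T\in M(\lambda)$ lie in the same set, and $S\le T$ iff $\lambda\le\mu$ when $S\in M(\lambda)$, $T\in M(\mu)$ with $\lambda\ne\mu$. $A$ is regarded as a subalgebra of $A_K$. Jucys-Murphy elements (Mathas): elements $L_1,\ldots,L_m$ of $A$ such that (a) $L_iL_j=L_jL_i$ for all $1\le i,j\le m$; (b) $i(L_j)=L_j$ for $j=1,\ldots,m$; (c) for all $\lambda\in\Lambda$,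 $S,T\in M(\lambda)$ and $i=1,\ldots,m$, $C_{S,T}^\lambda L_i\equiv c_T(i)C_{S,T}^\lambda+\sum_{V<T}r_{L_i}(V,T)C_{S,V}^\lambda \pmod{A(<\lambda)}$ (sum over $V\in M(\lambda)$ with $V<T$), where $c_T(i)\in R$ and $r_{L_i}(V,T)\in R$. The element $c_T(i)$ is called the content of $T$ at $i$. Separation condition: for any $S,T\in M(\Lambda)$ with $S\le T$ and $S\ne T$ there exists some $i$ with $1\le i\le m$ such that $c_S(i)\ne c_T(i)$. Notation $c_\lambda(i)$: when every symmetric polynomial in $L_1,\ldots,L_m$ belongs to the center of $A_K$, for every $\lambda\in\Lambda$ and $S,T\in M(\lambda)$ the families $\{c_S(i)\mid 1\le i\le m\}$ and $\{c_T(i)\mid 1\le i\le m\}$ coincide up to order (as multisets). Any one of them is denoted by $\{c_\lambda(i)\mid 1\le i\le m\}$; i.e. one may put $c_\lambda(i)=c_T(i)$ for any fixed choice of $T\in M(\lambda)$. *)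

theory Defs
  imports
    "HOL.Modules"
    "HOL-Computational_Algebra.Fraction_Field"
    "HOL-Library.Poly_Mapping"
    "HOL-Combinatorics.Permutations"
    "HOL-Algebra.QuotRing"
    "HOL-Algebra.Generated_Groups"
begin

section \<open>Associative unital algebras\<close>

text \<open>
  The sort \<open>{ring, monoid_mult}\<close> is that of unital, not necessarily commutative rings; unlike
  \<open>ring_1\<close> it does not exclude the zero ring. The locale name \<open>module\<close> is
  qualified because HOL-Algebra has another locale of that name.
\<close>

locale assoc_algebra = Modules.module scale
  for scale :: "'r::idom \<Rightarrow> 'a::{ring,monoid_mult} \<Rightarrow> 'a" (infixr \<open>*s\<close> 75) +
  assumes scale_mult_left: "(r *s x) * y = r *s (x * y)"
    and scale_mult_right: "x * (r *s y) = r *s (x * y)"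

section \<open>Cellular algebras\<close>

definition cell_lower ::
    "('r::idom \<Rightarrow> 'a::{ring,monoid_mult} \<Rightarrow> 'a) \<Rightarrow> 'l set \<Rightarrow> 'l rel \<Rightarrow> ('l \<Rightarrow> 's set) \<Rightarrow>
     ('l \<Rightarrow> 's \<Rightarrow> 's \<Rightarrow> 'a) \<Rightarrow> 'l \<Rightarrow> 'a set" where
  "cell_lower scale \<Lambda> leL M C l =
     module.span scale
       {C m S T | m S T. m \<in> \<Lambda> \<and> (m, l) \<in> leL \<and> m \<noteq> l \<and> S \<in> M m \<and> T \<in> M m}"

text \<open>
  The order relations \<open>leL\<close> on \<open>\<Lambda>\<close> and \<open>leM l\<close> on \<open>M l\<close> are the reflexive ones:
  \<open>(x, y) \<in> leL\<close> means \<open>x \<le> y\<close>. The sets \<open>M l\<close> need not be disjoint as sets of type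
  \<open>'s\<close>; an element of their disjoint union is a pair in \<open>Sigma \<Lambda> M\<close>.
\<close>

locale cellular_algebra = assoc_algebra scale
  for scale :: "'r::idom \<Rightarrow> 'a::{ring,monoid_mult} \<Rightarrow> 'a" (infixr \<open>*s\<close> 75) +
  fixes \<Lambda> :: "'l set" and leL :: "'l rel"
    and M :: "'l \<Rightarrow> 's set" and leM :: "'l \<Rightarrow> 's rel"
    and C :: "'l \<Rightarrow> 's \<Rightarrow> 's \<Rightarrow> 'a" and \<iota> :: "'a \<Rightarrow> 'a"
  assumes finite_Lambda: "finite \<Lambda>"
    and order_Lambda: "partial_order_on \<Lambda> leL"
    and finite_M: "l \<in> \<Lambda> \<Longrightarrow> finite (M l)"
    and nonempty_M: "l \<in> \<Lambda> \<Longrightarrow> M l \<noteq> {}"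
    and order_M: "l \<in> \<Lambda> \<Longrightarrow> partial_order_on (M l) (leM l)"
    and basis_inj: "inj_on (\<lambda>(l, S, T). C l S T) (SIGMA l:\<Lambda>. M l \<times> M l)"
    and basis_indep: "independent ((\<lambda>(l, S, T). C l S T) ` (SIGMA l:\<Lambda>. M l \<times> M l))"
    and basis_span: "span ((\<lambda>(l, S, T). C l S T) ` (SIGMA l:\<Lambda>. M l \<times> M l)) = UNIV"
    and anti_linear: "module_hom scale scale \<iota>"
    and anti_mult: "\<iota> (x * y) = \<iota> y * \<iota> x"
    and anti_involution: "\<iota> (\<iota> x) = x"
    and anti_basis: "l \<in> \<Lambda> \<Longrightarrow> S \<in> M l \<Longrightarrow> T \<in> M l \<Longrightarrow> \<iota> (C l S T) = C l T S"
    and cell_mult: "l \<in> \<Lambda> \<Longrightarrow>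
      \<exists>r. \<forall>S\<in>M l. \<forall>T\<in>M l.
        a * C l S T - (\<Sum>S'\<in>M l. r S' S *s C l S' T) \<in> cell_lower scale \<Lambda> leL M C l"

section \<open>Jucys-Murphy elements\<close>

text \<open>\<open>c l T i\<close> is the content at \<open>i\<close> of the element \<open>T\<close> of \<open>M l\<close>.\<close>

locale jucys_murphy = cellular_algebra scale \<Lambda> leL M leM C \<iota>
  for scale :: "'r::idom \<Rightarrow> 'a::{ring,monoid_mult} \<Rightarrow> 'a" (infixr \<open>*s\<close> 75)
    and \<Lambda> :: "'l set" and leL :: "'l rel"
    and M :: "'l \<Rightarrow> 's set" and leM :: "'l \<Rightarrow> 's rel"
    and C :: "'l \<Rightarrow> 's \<Rightarrow> 's \<Rightarrow> 'a" and \<iota> :: "'a \<Rightarrow> 'a" +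
  fixes m :: nat and L :: "nat \<Rightarrow> 'a" and c :: "'l \<Rightarrow> 's \<Rightarrow> nat \<Rightarrow> 'r"
  assumes JM_commute: "i \<in> {1..m} \<Longrightarrow> j \<in> {1..m} \<Longrightarrow> L i * L j = L j * L i"
    and JM_fixed: "j \<in> {1..m} \<Longrightarrow> \<iota> (L j) = L j"
    and JM_triangular: "l \<in> \<Lambda> \<Longrightarrow> i \<in> {1..m} \<Longrightarrow>
      \<exists>r. \<forall>S\<in>M l. \<forall>T\<in>M l.
        C l S T * L i -
          (c l T i *s C l S T + (\<Sum>V\<in>{V\<in>M l. (V, T) \<in> leM l \<and> V \<noteq> T}. r V T *s C l S V))
        \<in> cell_lower scale \<Lambda> leL M C l"

definition tableau_le :: "'l rel \<Rightarrow> ('l \<Rightarrow> 's rel) \<Rightarrow> 'l \<times> 's \<Rightarrow> 'l \<times> 's \<Rightarrow> bool" where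
  "tableau_le leL leM x y \<longleftrightarrow>
     (if fst x = fst y then (snd x, snd y) \<in> leM (fst x) else (fst x, fst y) \<in> leL)"

definition separation_condition ::
    "'l set \<Rightarrow> 'l rel \<Rightarrow> ('l \<Rightarrow> 's set) \<Rightarrow> ('l \<Rightarrow> 's rel) \<Rightarrow> nat \<Rightarrow> ('l \<Rightarrow> 's \<Rightarrow> nat \<Rightarrow> 'r) \<Rightarrow> bool"
  where
  "separation_condition \<Lambda> leL M leM m c \<longleftrightarrow>
     (\<forall>x\<in>Sigma \<Lambda> M. \<forall>y\<in>Sigma \<Lambda> M. tableau_le leL leM x y \<and> x \<noteq> y \<longrightarrow>
        (\<exists>i\<in>{1..m}. c (fst x) (snd x) i \<noteq> c (fst y) (snd y) i))"

section \<open>Extension of scalars to the field of fractions\<close>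

text \<open>
  For an \<open>R\<close>-algebra \<open>A\<close> and \<open>K = Frac R\<close>, the tensor product of \<open>A\<close> and \<open>K\<close> over \<open>R\<close> is the
  free abelian group on \<open>A \<times> K\<close> modulo the subgroup generated by the bilinearity relations; its
  multiplication is induced by \<open>(a, k) (b, h) = (a b, k h)\<close>, i.e. by the monoid ring of
  \<open>A \<times> K\<close> over the integers. (The multiplication of \<open>poly_mapping\<close> in the library is
  not applicable: it comes from an additive structure on the exponents.)
\<close>

definition pair_ring :: "(('a::{ring,monoid_mult} \<times> 'k::field) \<Rightarrow>\<^sub>0 int) ring" where
  "pair_ring =
     \<lparr>carrier = UNIV,
      mult = (\<lambda>f g. \<Sum>x\<in>Poly_Mapping.keys f. \<Sum>y\<in>Poly_Mapping.keys g.
        Poly_Mapping.single (fst x * fst y, snd x * snd y)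
          (Poly_Mapping.lookup f x * Poly_Mapping.lookup g y)),
      one = Poly_Mapping.single (1, 1) 1,
      zero = 0,
      add = (+)\<rparr>"

definition tensor_relations ::
    "('r::idom \<Rightarrow> 'a::{ring,monoid_mult} \<Rightarrow> 'a) \<Rightarrow> (('a \<times> 'r fract) \<Rightarrow>\<^sub>0 int) set" where
  "tensor_relations scale =
     (let e = (\<lambda>a k. Poly_Mapping.single (a, k) 1) in
       {e (a + b) k - e a k - e b k | a b k. True} \<union>
       {e a (k + h) - e a k - e a h | a k h. True} \<union>
       {e (scale r a) k - e a (Fract r 1 * k) | r a k. True})"

definition tensor_kernel ::
    "('r::idom \<Rightarrow> 'a::{ring,monoid_mult} \<Rightarrow> 'a) \<Rightarrow> (('a \<times> 'r fract) \<Rightarrow>\<^sub>0 int) set" where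
  "tensor_kernel scale = generate (add_monoid pair_ring) (tensor_relations scale)"

definition scalar_ext ::
    "('r::idom \<Rightarrow> 'a::{ring,monoid_mult} \<Rightarrow> 'a) \<Rightarrow> (('a \<times> 'r fract) \<Rightarrow>\<^sub>0 int) set ring" where
  "scalar_ext scale = pair_ring Quot tensor_kernel scale"

definition tensor ::
    "('r::idom \<Rightarrow> 'a::{ring,monoid_mult} \<Rightarrow> 'a) \<Rightarrow> 'a \<Rightarrow> 'r fract \<Rightarrow>
     (('a \<times> 'r fract) \<Rightarrow>\<^sub>0 int) set" where
  "tensor scale a k = tensor_kernel scale +>\<^bsub>pair_ring\<^esub> Poly_Mapping.single (a, k) 1"

definition ring_center :: "('a, 'b) ring_scheme \<Rightarrow> 'a set" where
  "ring_center G = {z \<in> carrier G. \<forall>x\<in>carrier G. z \<otimes>\<^bsub>G\<^esub> x = x \<otimes>\<^bsub>G\<^esub> z}"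

section \<open>Symmetric polynomials\<close>

text \<open>
  A polynomial is a finitely supported function from exponent vectors \<open>nat \<Rightarrow>\<^sub>0 nat\<close> to
  coefficients; the variables are \<open>X 1, \<dots>, X m\<close>.
\<close>

definition symmetric_polys :: "nat \<Rightarrow> ((nat \<Rightarrow>\<^sub>0 nat) \<Rightarrow>\<^sub>0 'k::zero) set" where
  "symmetric_polys m =
     {p. (\<forall>e\<in>Poly_Mapping.keys p. Poly_Mapping.keys e \<subseteq> {1..m}) \<and>
         (\<forall>\<sigma> e. \<sigma> permutes {1..m} \<longrightarrow>
            Poly_Mapping.lookup p (Poly_Mapping.map_key \<sigma> e) = Poly_Mapping.lookup p e)}"

text \<open>
  Since the \<open>L i\<close> commute, the order of the factors is irrelevant when the definitions below are
  used. An element \<open>a\<close> of \<open>A\<close> is identified with \<open>tensor scale a 1\<close>, so that \<open>k\<close> times \<open>a\<close> is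
  \<open>tensor scale a k\<close>.
\<close>

definition monomial_at :: "nat \<Rightarrow> (nat \<Rightarrow> 'a::monoid_mult) \<Rightarrow> (nat \<Rightarrow>\<^sub>0 nat) \<Rightarrow> 'a" where
  "monomial_at m L e = (\<Prod>i\<leftarrow>[1..<Suc m]. L i ^ Poly_Mapping.lookup e i)"

definition poly_at ::
    "('r::idom \<Rightarrow> 'a::{ring,monoid_mult} \<Rightarrow> 'a) \<Rightarrow> nat \<Rightarrow> (nat \<Rightarrow> 'a) \<Rightarrow>
     ((nat \<Rightarrow>\<^sub>0 nat) \<Rightarrow>\<^sub>0 'r fract) \<Rightarrow> (('a \<times> 'r fract) \<Rightarrow>\<^sub>0 int) set" where
  "poly_at scale m L p =
     (\<Oplus>\<^bsub>scalar_ext scale\<^esub>e\<in>Poly_Mapping.keys p.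
        tensor scale (monomial_at m L e) (Poly_Mapping.lookup p e))"

end

theory Submission
  imports Defs "HOL-Computational_Algebra.Polynomial" "HOL-Library.Function_Algebras"
begin

text \<open>
  The separation condition makes the extended algebra a product of matrix algebras, one for each
  cell; its center is then the set of families of scalars indexed by the cells, and a symmetric
  polynomial in the Jucys-Murphy elements corresponds to the family of its values at the contents
  of the cells. So the statement becomes one about values: every family of scalars is the family
  of values of a symmetric polynomial if and only if the content vectors of different cells are
  not permutations of each other.

  The heart is \<open>gram_nondegenerate\<close>. Let \<open>v\<close> be a nonzero vector of the cell module of \<open>l\<close> in the
  radical of its Gram form, that is, killed by all \<open>C l S T\<close>. As \<open>1\<close> does not kill \<open>v\<close>, the cells
  do not all kill it; let \<open>u\<close> be minimal among those that do not. Then \<open>u > l\<close>, and since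
  everything below \<open>u\<close> kills \<open>v\<close>, the map \<open>C u S T \<mapsto> C u S T v\<close>, for a suitable fixed \<open>T\<close>, is a
  nonzero homomorphism from the cell module of \<open>u\<close> to that of \<open>l\<close>. It commutes with the
  Jucys-Murphy elements, which are triangular on both modules with the contents on the diagonal;
  an extremal nonzero entry of the homomorphism forces an element of \<open>M l\<close> and one of \<open>M u\<close> to
  have the same contents, against separation (\<open>intertwiner_eq_0\<close>).

  Nondegenerate Gram forms make the cell representations jointly faithful (\<open>rep_faithful\<close>): in a
  cell maximal in the support of \<open>a\<close>, the representing matrix of \<open>a\<close> is the coefficient matrix of \<open>a\<close>
  times the Gram matrix. Clearing denominators, this holds over the field of fractions too, and
  there a count of dimensions turns the injective map into an isomorphism with the product of
  the matrix algebras (\<open>wedderburn_iso\<close>).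

  A symmetric polynomial in the Jucys-Murphy elements acts on each cell module by a triangular
  matrix whose diagonal holds its values at the contents. Being central it is a scalar on each
  cell, so it is determined by its value at any one content vector per cell
  (\<open>wedderburn_central_poly\<close>). Symmetric polynomials agree at permuted points, which proves
  one direction. For the other, the elementary symmetric polynomials are the coefficients of
  \<open>\<Prod>i. X + x i\<close> and so separate points that are not permutations of each other; products of such
  separating polynomials interpolate arbitrary values (\<open>symmetric_interpolation\<close>).
\<close>

section \<open>Cell representations of a cellular algebra\<close>

context cellular_algebra
begin

definition idx :: "('l \<times> 's \<times> 's) set" where
  "idx = (SIGMA l:\<Lambda>. M l \<times> M l)"

abbreviation cell_basis :: "'a set" where
  "cell_basis \<equiv> (\<lambda>(l, S, T). C l S T) ` idx"

definition coord :: "'a \<Rightarrow> 'l \<Rightarrow> 's \<Rightarrow> 's \<Rightarrow> 'r" where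
  "coord a l S T = representation cell_basis a (C l S T)"

abbreviation lower :: "'l \<Rightarrow> 'a set" where
  "lower \<equiv> cell_lower scale \<Lambda> leL M C"

lemma mem_idx [simp]: "(l, S, T) \<in> idx \<longleftrightarrow> l \<in> \<Lambda> \<and> S \<in> M l \<and> T \<in> M l"
  by (auto simp: idx_def)

lemma finite_idx: "finite idx"
  unfolding idx_def by (intro finite_SigmaI finite_Lambda finite_cartesian_product finite_M)

lemma coord_add: "coord (a + b) l S T = coord a l S T + coord b l S T"
  unfolding coord_def idx_def by (subst representation_add) (use basis_indep basis_span in auto)

lemma coord_diff: "coord (a - b) l S T = coord a l S T - coord b l S T"
  unfolding coord_def idx_def by (subst representation_diff) (use basis_indep basis_span in auto)

lemma coord_scale: "coord (r *s a) l S T = r * coord a l S T"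
  unfolding coord_def idx_def by (subst representation_scale) (use basis_indep basis_span in auto)

lemma coord_0: "coord 0 l S T = 0"
  unfolding coord_def by (simp add: representation_zero)

lemma coord_sum: "coord (\<Sum>x\<in>X. f x) l S T = (\<Sum>x\<in>X. coord (f x) l S T)"
  by (induction X rule: infinite_finite_induct) (auto simp: coord_0 coord_add)

lemma coord_basis:
  assumes "(l, S, T) \<in> idx" "(l', S', T') \<in> idx"
  shows "coord (C l S T) l' S' T' = (if l' = l \<and> S' = S \<and> T' = T then 1 else 0)"
proof -
  have "C l S T \<in> cell_basis" using assms(1) by (intro image_eqI[where x = "(l, S, T)"]) auto
  then have "coord (C l S T) l' S' T' = (if C l' S' T' = C l S T then 1 else 0)"
    unfolding coord_def using representation_basis basis_indep by (simp add: idx_def)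
  moreover have "C l' S' T' = C l S T \<longleftrightarrow> (l', S', T') = (l, S, T)"
    using inj_onD[OF basis_inj[folded idx_def], of "(l', S', T')" "(l, S, T)"] assms by auto
  ultimately show ?thesis by simp
qed

lemma coord_expand: "a = (\<Sum>(l, S, T)\<in>idx. coord a l S T *s C l S T)"
proof -
  have "a = (\<Sum>b\<in>cell_basis. representation cell_basis a b *s b)"
    by (rule sum_representation_eq[symmetric])
      (use basis_indep basis_span finite_idx in \<open>auto simp: idx_def\<close>)
  also have "\<dots> = (\<Sum>x\<in>idx. representation cell_basis a ((\<lambda>(l, S, T). C l S T) x) *s
      ((\<lambda>(l, S, T). C l S T) x))"
    by (rule sum.reindex_cong[OF basis_inj[folded idx_def]]) auto
  finally show ?thesis by (simp add: coord_def case_prod_unfold)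
qed

lemma coord_lincomb:
  assumes "(l, S, T) \<in> idx"
  shows "coord (\<Sum>(l, S, T)\<in>idx. x l S T *s C l S T) l S T = x l S T"
proof -
  have "coord (\<Sum>(l, S, T)\<in>idx. x l S T *s C l S T) l S T =
      (\<Sum>y\<in>idx. if y = (l, S, T) then x l S T else 0)"
    unfolding coord_sum
    by (rule sum.cong) (use assms in \<open>auto simp: coord_scale coord_basis simp del: mem_idx split: if_splits\<close>)
  also have "\<dots> = x l S T" using assms finite_idx by (simp add: sum.delta)
  finally show ?thesis .
qed

lemma leL_refl: "l \<in> \<Lambda> \<Longrightarrow> (l, l) \<in> leL"
  and leL_trans: "(l, u) \<in> leL \<Longrightarrow> (u, v) \<in> leL \<Longrightarrow> (l, v) \<in> leL"
  and leL_antisym: "(l, u) \<in> leL \<Longrightarrow> (u, l) \<in> leL \<Longrightarrow> l = u"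
  using order_Lambda unfolding partial_order_on_def preorder_on_def
  by (auto dest: refl_onD transD antisymD)

lemma coord_lower:
  assumes "a \<in> lower l" "(u, S, T) \<in> idx" "coord a u S T \<noteq> 0"
  shows "(u, l) \<in> leL \<and> u \<noteq> l"
proof -
  have "a \<in> {a. coord a u S T \<noteq> 0 \<longrightarrow> (u, l) \<in> leL \<and> u \<noteq> l}"
    using assms(1) unfolding cell_lower_def
  proof (rule span_subspace_induct)
    show "subspace {a. coord a u S T \<noteq> 0 \<longrightarrow> (u, l) \<in> leL \<and> u \<noteq> l}"
      by (auto simp: subspace_def coord_0 coord_add coord_scale)
  qed (use assms(2) in \<open>auto simp: coord_basis split: if_splits\<close>)
  then show ?thesis using assms(3) by blast
qed

lemma coord_lower_self: "a \<in> lower l \<Longrightarrow> (l, S, T) \<in> idx \<Longrightarrow> coord a l S T = 0"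
  using coord_lower by blast

lemma basis_in_lower: "u \<in> \<Lambda> \<Longrightarrow> S \<in> M u \<Longrightarrow> T \<in> M u \<Longrightarrow> (u, l) \<in> leL \<Longrightarrow> u \<noteq> l \<Longrightarrow> C u S T \<in> lower l"
  unfolding cell_lower_def by (rule span_base) auto

lemma lower_mono: "(u, l) \<in> leL \<Longrightarrow> lower u \<subseteq> lower l"
  unfolding cell_lower_def
  by (rule span_mono) (use leL_trans leL_antisym in blast)

lemma subspace_lower: "subspace (lower l)"
  unfolding cell_lower_def by (rule subspace_span)

lemmas lower_0 = subspace_0[OF subspace_lower]
  and lower_add = subspace_add[OF subspace_lower]
  and lower_scale = subspace_scale[OF subspace_lower]
  and lower_sum = subspace_sum[OF subspace_lower]

text \<open>
  A product \<open>a * C u S T\<close> only involves cells that are at most \<open>u\<close>. This stability makes congruences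
  modulo lower cells compatible with left multiplication, hence \<open>rep\<close> below multiplicative.
\<close>

lemma mult_lower_left:
  assumes "x \<in> lower l"
  shows "a * x \<in> lower l"
proof -
  have "x \<in> {x. a * x \<in> lower l}"
    using assms[unfolded cell_lower_def]
  proof (rule span_subspace_induct)
    show "subspace {x. a * x \<in> lower l}"
      by (intro subspaceI) (simp_all add: distrib_left scale_mult_right lower_0 lower_add lower_scale)
  next
    fix x assume "x \<in> {C u S T |u S T. u \<in> \<Lambda> \<and> (u, l) \<in> leL \<and> u \<noteq> l \<and> S \<in> M u \<and> T \<in> M u}"
    then obtain u S T where u: "x = C u S T" "u \<in> \<Lambda>" "(u, l) \<in> leL" "u \<noteq> l" "S \<in> M u" "T \<in> M u"
      by blast
    obtain r where "\<forall>S\<in>M u. \<forall>T\<in>M u. a * C u S T - (\<Sum>S'\<in>M u. r S' S *s C u S' T) \<in> lower u"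
      using cell_mult[OF u(2)] ..
    then have r: "a * C u S T - (\<Sum>S'\<in>M u. r S' S *s C u S' T) \<in> lower u"
      using u(5,6) by simp
    have "(\<Sum>S'\<in>M u. r S' S *s C u S' T) \<in> lower l"
      by (intro lower_sum lower_scale basis_in_lower u)
    from lower_add[OF subsetD[OF lower_mono[OF u(3)] r] this]
    have "a * x \<in> lower l" by (simp add: u(1))
    then show "x \<in> {x. a * x \<in> lower l}" by simp
  qed
  then show ?thesis by simp
qed

lemma iota_add: "\<iota> (a + b) = \<iota> a + \<iota> b"
  and iota_scale: "\<iota> (r *s a) = r *s \<iota> a"
  and iota_0: "\<iota> 0 = 0"
  and iota_diff: "\<iota> (a - b) = \<iota> a - \<iota> b"
  and iota_sum: "\<iota> (\<Sum>x\<in>X. f x) = (\<Sum>x\<in>X. \<iota> (f x))"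
  by (rule module_hom.add[OF anti_linear] module_hom.scale[OF anti_linear]
      module_hom.zero[OF anti_linear] module_hom.diff[OF anti_linear]
      module_hom.sum[OF anti_linear])+

lemma iota_lower:
  assumes "x \<in> lower l"
  shows "\<iota> x \<in> lower l"
proof -
  have "x \<in> {x. \<iota> x \<in> lower l}"
    using assms[unfolded cell_lower_def]
  proof (rule span_subspace_induct)
    show "subspace {x. \<iota> x \<in> lower l}"
      by (intro subspaceI) (simp_all add: iota_0 iota_add iota_scale lower_0 lower_add lower_scale)
  qed (auto simp: anti_basis intro!: basis_in_lower)
  then show ?thesis by simp
qed

text \<open>
  The matrix of left multiplication by \<open>a\<close> on the cell module of \<open>l\<close>. Axiom \<open>cell_mult\<close> makes the
  choice of the second index \<open>T\<close> irrelevant (\<open>rep_eq\<close>).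
\<close>

definition rep :: "'l \<Rightarrow> 'a \<Rightarrow> 's \<Rightarrow> 's \<Rightarrow> 'r" where
  "rep l a S' S = (let T = SOME T. T \<in> M l in coord (a * C l S T) l S' T)"

lemma coord_mod_lower:
  assumes "x - (\<Sum>S\<in>M l. r S *s C l S T) \<in> lower l" "l \<in> \<Lambda>" "S' \<in> M l" "T' \<in> M l" "T \<in> M l"
  shows "coord x l S' T' = (if T' = T then r S' else 0)"
proof -
  have "coord x l S' T' = (\<Sum>S\<in>M l. r S * coord (C l S T) l S' T')"
    using coord_lower_self[OF assms(1), of S' T'] assms
    by (simp add: coord_diff coord_sum coord_scale)
  also have "\<dots> = (\<Sum>S\<in>M l. if S = S' then if T' = T then r S' else 0 else 0)"
    by (rule sum.cong) (use assms in \<open>auto simp: coord_basis\<close>)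
  finally show ?thesis using assms finite_M by simp
qed

lemma rep_cong:
  assumes "l \<in> \<Lambda>" "S \<in> M l" "T \<in> M l"
  shows "a * C l S T - (\<Sum>S'\<in>M l. rep l a S' S *s C l S' T) \<in> lower l"
proof -
  obtain r where "\<forall>S\<in>M l. \<forall>T\<in>M l. a * C l S T - (\<Sum>S'\<in>M l. r S' S *s C l S' T) \<in> lower l"
    using cell_mult[OF assms(1)] ..
  then have r: "\<And>S T. S \<in> M l \<Longrightarrow> T \<in> M l \<Longrightarrow> a * C l S T - (\<Sum>S'\<in>M l. r S' S *s C l S' T) \<in> lower l"
    by simp
  have *: "(SOME T. T \<in> M l) \<in> M l" using assms(2) by (rule someI)
  have "rep l a S' S = r S' S" if "S' \<in> M l" for S'
    unfolding rep_def Let_def using coord_mod_lower[OF r assms(1) that * *] assms * by simp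
  then show ?thesis using r[OF assms(2,3)] by (simp cong: sum.cong)
qed

lemma coord_mult_basis:
  assumes "l \<in> \<Lambda>" "S \<in> M l" "T \<in> M l" "S' \<in> M l" "T' \<in> M l"
  shows "coord (a * C l S T) l S' T' = (if T' = T then rep l a S' S else 0)"
  by (rule coord_mod_lower[OF rep_cong]) (use assms in auto)

lemma rep_eq:
  assumes "l \<in> \<Lambda>" "S \<in> M l" "T \<in> M l" "S' \<in> M l"
  shows "rep l a S' S = coord (a * C l S T) l S' T"
  using coord_mult_basis[of l S T S' T] assms by simp

lemma rep_add:
  "l \<in> \<Lambda> \<Longrightarrow> S' \<in> M l \<Longrightarrow> S \<in> M l \<Longrightarrow> rep l (a + b) S' S = rep l a S' S + rep l b S' S"
  using rep_eq[of l S S S'] by (simp add: distrib_right coord_add)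

lemma rep_scale:
  "l \<in> \<Lambda> \<Longrightarrow> S' \<in> M l \<Longrightarrow> S \<in> M l \<Longrightarrow> rep l (r *s a) S' S = r * rep l a S' S"
  using rep_eq[of l S S S'] by (simp add: scale_mult_left coord_scale)

lemma rep_0: "l \<in> \<Lambda> \<Longrightarrow> S' \<in> M l \<Longrightarrow> S \<in> M l \<Longrightarrow> rep l 0 S' S = 0"
  using rep_eq[of l S S S'] by (simp add: coord_0)

lemma rep_sum:
  "l \<in> \<Lambda> \<Longrightarrow> S' \<in> M l \<Longrightarrow> S \<in> M l \<Longrightarrow> rep l (\<Sum>x\<in>X. f x) S' S = (\<Sum>x\<in>X. rep l (f x) S' S)"
  by (induction X rule: infinite_finite_induct) (auto simp: rep_0 rep_add)

lemma rep_1: "l \<in> \<Lambda> \<Longrightarrow> S' \<in> M l \<Longrightarrow> S \<in> M l \<Longrightarrow> rep l 1 S' S = (if S' = S then 1 else 0)"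
  using rep_eq[of l S S S'] by (simp add: coord_basis)

lemma rep_mult:
  assumes "l \<in> \<Lambda>" "S' \<in> M l" "S \<in> M l"
  shows "rep l (a * b) S' S = (\<Sum>U\<in>M l. rep l a S' U * rep l b U S)"
proof -
  define y where "y = b * C l S S - (\<Sum>U\<in>M l. rep l b U S *s C l U S)"
  have y: "a * y \<in> lower l" unfolding y_def by (intro mult_lower_left rep_cong assms)
  have "a * b * C l S S = (\<Sum>U\<in>M l. rep l b U S *s (a * C l U S)) + a * y"
    by (simp add: y_def right_diff_distrib sum_distrib_left scale_mult_right mult.assoc)
  then have "rep l (a * b) S' S = (\<Sum>U\<in>M l. rep l b U S * rep l a S' U)"
    using rep_eq[of l S S S' "a * b"] assms coord_lower_self[OF y]
    by (simp add: coord_add coord_sum coord_scale coord_mult_basis)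
  then show ?thesis by (simp add: mult.commute)
qed

text \<open>
  The anti-automorphism turns the axiom on left multiplication into one on right multiplication.
\<close>

lemma basis_mult_cong:
  assumes "l \<in> \<Lambda>" "S \<in> M l" "T \<in> M l"
  shows "C l S T * a - (\<Sum>T'\<in>M l. rep l (\<iota> a) T' T *s C l S T') \<in> lower l"
  using iota_lower[OF rep_cong[OF assms(1,3,2), of "\<iota> a"]] assms
  by (simp add: iota_diff iota_sum iota_scale anti_mult anti_involution anti_basis cong: sum.cong)

text \<open>
  Seen as a right multiple of a basis element of \<open>u\<close>, the product \<open>C u S T * C l U U\<close> lies in the
  cells that are at most \<open>u\<close>; so it has no component in \<open>l\<close> unless \<open>l \<le> u\<close>.
\<close>

lemma rep_basis_le:
  assumes "u \<in> \<Lambda>" "S \<in> M u" "T \<in> M u" "l \<in> \<Lambda>" "U' \<in> M l" "U \<in> M l" "rep l (C u S T) U' U \<noteq> 0"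
  shows "(l, u) \<in> leL"
proof (rule ccontr)
  assume neg: "(l, u) \<notin> leL"
  then have "l \<noteq> u" using leL_refl assms by auto
  define y where "y = C u S T * C l U U - (\<Sum>T'\<in>M u. rep u (\<iota> (C l U U)) T' T *s C u S T')"
  have "y \<in> lower u" unfolding y_def by (intro basis_mult_cong assms)
  then have "coord y l U' U = 0" using coord_lower[of y u l U' U] neg assms by auto
  moreover have "coord (C u S T * C l U U) l U' U = coord y l U' U"
    using assms \<open>l \<noteq> u\<close> by (simp add: y_def coord_diff coord_sum coord_scale coord_basis cong: sum.cong)
  ultimately show False using assms rep_eq[of l U U U'] by simp
qed

text \<open>
  Expanding \<open>C l S T * C l U V\<close> as a left multiple and as a right multiple shows that, modulo lower
  cells, it is a multiple of \<open>C l S V\<close>. The factor is the entry at \<open>T, U\<close> of the Gram form of the cell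
  module, which thus appears both in row \<open>S\<close> of the matrix of \<open>C l S T\<close> and in row \<open>V\<close> of that of
  \<open>C l V U\<close>; comparing the two is the symmetry of the form.
\<close>

lemma rep_own_basis:
  assumes "l \<in> \<Lambda>" "S \<in> M l" "T \<in> M l" "S' \<in> M l" "U \<in> M l" "V \<in> M l"
  shows "rep l (C l S T) S' U = (if S' = S then rep l (C l V U) V T else 0)"
proof -
  define y where "y = C l S T * C l U V - (\<Sum>T'\<in>M l. rep l (C l V U) T' T *s C l S T')"
  have "y \<in> lower l" unfolding y_def
    using basis_mult_cong[of l S T "C l U V"] assms by (simp add: anti_basis)
  then have "coord y l S' V = 0" using coord_lower_self assms by auto
  then have "coord (C l S T * C l U V) l S' V =
      (\<Sum>T'\<in>M l. rep l (C l V U) T' T * coord (C l S T') l S' V)"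
    by (simp add: y_def coord_diff coord_sum coord_scale)
  also have "\<dots> = (\<Sum>T'\<in>M l. if T' = V then if S' = S then rep l (C l V U) V T else 0 else 0)"
    by (rule sum.cong) (use assms in \<open>auto simp: coord_basis\<close>)
  finally show ?thesis using assms finite_M rep_eq[of l U V S'] by simp
qed

definition act :: "'l \<Rightarrow> 'a \<Rightarrow> ('s \<Rightarrow> 'r) \<Rightarrow> 's \<Rightarrow> 'r" where
  "act l a v S = (\<Sum>U\<in>M l. rep l a S U * v U)"

lemma act_mult:
  assumes "l \<in> \<Lambda>" "S \<in> M l"
  shows "act l (a * b) v S = act l a (act l b v) S"
proof -
  have "act l (a * b) v S = (\<Sum>U\<in>M l. \<Sum>V\<in>M l. rep l a S V * rep l b V U * v U)"
    using assms by (simp add: act_def rep_mult sum_distrib_right cong: sum.cong)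
  also have "\<dots> = (\<Sum>V\<in>M l. \<Sum>U\<in>M l. rep l a S V * rep l b V U * v U)" by (rule sum.swap)
  finally show ?thesis by (simp add: act_def sum_distrib_left mult.assoc)
qed

lemma act_linear:
  assumes "l \<in> \<Lambda>" "S \<in> M l"
  shows "act l (a + b) v S = act l a v S + act l b v S"
    "act l (r *s a) v S = r * act l a v S" "act l 0 v S = 0"
    "act l (\<Sum>x\<in>X. f x) v S = (\<Sum>x\<in>X. act l (f x) v S)"
proof -
  show 1: "act l (a + b) v S = act l a v S + act l b v S" for a b
    using assms by (simp add: act_def rep_add distrib_right sum.distrib cong: sum.cong)
  show "act l (r *s a) v S = r * act l a v S"
    using assms by (simp add: act_def rep_scale sum_distrib_left mult.assoc cong: sum.cong)
  show 2: "act l 0 v S = 0"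
    using assms by (simp add: act_def rep_0)
  show "act l (\<Sum>x\<in>X. f x) v S = (\<Sum>x\<in>X. act l (f x) v S)"
    by (induction X rule: infinite_finite_induct) (auto simp: 1 2)
qed

end

section \<open>Separation makes the Gram forms nondegenerate\<close>

lemma finite_poset_extremal:
  assumes "partial_order_on B r" "finite A" "A \<noteq> {}"
  shows "\<exists>x\<in>A. \<forall>y\<in>A. (y, x) \<in> r \<longrightarrow> y = x" "\<exists>x\<in>A. \<forall>y\<in>A. (x, y) \<in> r \<longrightarrow> y = x"
proof -
  have t: "trans r" "antisym r" using assms(1) by (auto simp: partial_order_on_def preorder_on_def)
  then have "asymp_on A (\<lambda>x y. (x, y) \<in> r \<and> x \<noteq> y)" "transp_on A (\<lambda>x y. (x, y) \<in> r \<and> x \<noteq> y)"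
    unfolding asymp_on_def transp_on_def by (blast dest: transD antisymD)+
  note * = assms(2) this assms(3)
  show "\<exists>x\<in>A. \<forall>y\<in>A. (y, x) \<in> r \<longrightarrow> y = x" using Finite_Set.bex_min_element[OF *] by blast
  show "\<exists>x\<in>A. \<forall>y\<in>A. (x, y) \<in> r \<longrightarrow> y = x" using Finite_Set.bex_max_element[OF *] by blast
qed

context jucys_murphy
begin

text \<open>
  The contents are defined by right multiplication, but \<open>L i\<close> is fixed by the anti-automorphism, so
  left multiplication by it is triangular as well, with the same diagonal.
\<close>

lemma rep_JM:
  assumes "l \<in> \<Lambda>" "i \<in> {1..m}" "V \<in> M l" "T \<in> M l"
  shows "rep l (L i) T T = c l T i" "V \<noteq> T \<Longrightarrow> rep l (L i) V T \<noteq> 0 \<Longrightarrow> (V, T) \<in> leM l"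
proof -
  obtain r where "\<forall>S\<in>M l. \<forall>T\<in>M l. C l S T * L i -
      (c l T i *s C l S T + (\<Sum>V\<in>{V\<in>M l. (V, T) \<in> leM l \<and> V \<noteq> T}. r V T *s C l S V)) \<in> lower l"
    using JM_triangular[OF assms(1,2)] ..
  then have r: "\<And>S T. S \<in> M l \<Longrightarrow> T \<in> M l \<Longrightarrow> C l S T * L i -
      (c l T i *s C l S T + (\<Sum>V\<in>{V\<in>M l. (V, T) \<in> leM l \<and> V \<noteq> T}. r V T *s C l S V)) \<in> lower l"
    by simp
  define X where "X = {V\<in>M l. (V, T) \<in> leM l \<and> V \<noteq> T}"
  have [simp]: "finite X" "X \<subseteq> M l" using finite_M[OF assms(1)] unfolding X_def by auto
  have "L i * C l T T - (c l T i *s C l T T + (\<Sum>V\<in>X. r V T *s C l V T)) \<in> lower l"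
  proof -
    have "(\<Sum>V\<in>X. r V T *s \<iota> (C l T V)) = (\<Sum>V\<in>X. r V T *s C l V T)"
      by (rule sum.cong) (use assms in \<open>auto simp: X_def anti_basis\<close>)
    then show ?thesis
      using iota_lower[OF r[OF assms(4,4)]] assms unfolding X_def[symmetric]
      by (simp add: iota_diff iota_sum iota_add iota_scale anti_mult anti_basis JM_fixed)
  qed
  from coord_lower_self[OF this] assms
  have "coord (L i * C l T T) l V T =
      c l T i * coord (C l T T) l V T + (\<Sum>V'\<in>X. r V' T * coord (C l V' T) l V T)" if "V \<in> M l" for V
    using that by (simp add: coord_diff coord_add coord_sum coord_scale)
  moreover have "(\<Sum>V'\<in>X. r V' T * coord (C l V' T) l V T) = (\<Sum>V'\<in>X. if V' = V then r V T else 0)"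
    if "V \<in> M l" for V
    by (rule sum.cong) (use that assms in \<open>auto simp: X_def coord_basis\<close>)
  ultimately have *: "rep l (L i) V T = (if V = T then c l T i else 0) + (if V \<in> X then r V T else 0)"
    if "V \<in> M l" for V
    using that assms rep_eq[of l T T V] by (simp add: coord_basis)
  show "rep l (L i) T T = c l T i" using *[of T] assms by (simp add: X_def)
  show "(V, T) \<in> leM l" if "V \<noteq> T" "rep l (L i) V T \<noteq> 0"
    using *[of V] that assms by (simp add: X_def split: if_splits)
qed

text \<open>
  A homomorphism between the cell modules of comparable cells vanishes. Take a nonzero entry
  whose row is maximal among the nonzero rows and whose column is minimal among the nonzero
  entries of this row. As the Jucys-Murphy elements are triangular, at this entry both sides of
  the commutation relation reduce to their diagonal terms, so the contents of row and column
  agree.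
\<close>

lemma intertwiner_eq_0:
  assumes sep: "separation_condition \<Lambda> leL M leM m c"
    and l: "l \<in> \<Lambda>" and u: "u \<in> \<Lambda>" and lu: "(l, u) \<in> leL" "l \<noteq> u"
    and comm: "\<And>i S S'. i \<in> {1..m} \<Longrightarrow> S \<in> M u \<Longrightarrow> S' \<in> M l \<Longrightarrow>
      (\<Sum>V\<in>M l. rep l (L i) S' V * \<theta> V S) = (\<Sum>V\<in>M u. \<theta> S' V * rep u (L i) V S)"
    and S: "S \<in> M u" "S' \<in> M l"
  shows "\<theta> S' S = 0"
proof (rule ccontr)
  assume ne: "\<theta> S' S \<noteq> 0"
  define X where "X = {V \<in> M l. \<exists>W\<in>M u. \<theta> V W \<noteq> 0}"
  have "finite X" "X \<noteq> {}" using finite_M[OF l] ne S by (auto simp: X_def)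
  then obtain V where V: "V \<in> X" "\<And>V'. V' \<in> X \<Longrightarrow> (V, V') \<in> leM l \<Longrightarrow> V' = V"
    using finite_poset_extremal(2)[OF order_M[OF l]] by meson
  define Y where "Y = {W \<in> M u. \<theta> V W \<noteq> 0}"
  have "finite Y" "Y \<noteq> {}" using finite_M[OF u] V(1) by (auto simp: X_def Y_def)
  then obtain W where W: "W \<in> Y" "\<And>W'. W' \<in> Y \<Longrightarrow> (W', W) \<in> leM u \<Longrightarrow> W' = W"
    using finite_poset_extremal(1)[OF order_M[OF u]] by meson
  have VW: "V \<in> M l" "W \<in> M u" "\<theta> V W \<noteq> 0" using V(1) W(1) by (auto simp: X_def Y_def)
  have "c l V i = c u W i" if i: "i \<in> {1..m}" for i
  proof -
    have "(\<Sum>V'\<in>M l. rep l (L i) V V' * \<theta> V' W) = (\<Sum>V'\<in>M l. if V' = V then c l V i * \<theta> V W else 0)"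
    proof (rule sum.cong[OF refl])
      fix V' assume V': "V' \<in> M l"
      have "rep l (L i) V V' = 0 \<or> \<theta> V' W = 0" if "V' \<noteq> V"
        using rep_JM(2)[OF l i VW(1) V'] V(2)[of V'] that V' VW(2) by (auto simp: X_def)
      then show "rep l (L i) V V' * \<theta> V' W = (if V' = V then c l V i * \<theta> V W else 0)"
        using rep_JM(1)[OF l i V' V'] by auto
    qed
    also have "\<dots> = c l V i * \<theta> V W" using VW finite_M[OF l] by simp
    finally have 1: "(\<Sum>V'\<in>M l. rep l (L i) V V' * \<theta> V' W) = c l V i * \<theta> V W" .
    have "(\<Sum>W'\<in>M u. \<theta> V W' * rep u (L i) W' W) = (\<Sum>W'\<in>M u. if W' = W then \<theta> V W * c u W i else 0)"
    proof (rule sum.cong[OF refl])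
      fix W' assume W': "W' \<in> M u"
      have "rep u (L i) W' W = 0 \<or> \<theta> V W' = 0" if "W' \<noteq> W"
        using rep_JM(2)[OF u i W' VW(2)] W(2)[of W'] that W' by (auto simp: Y_def)
      then show "\<theta> V W' * rep u (L i) W' W = (if W' = W then \<theta> V W * c u W i else 0)"
        using rep_JM(1)[OF u i W' W'] by auto
    qed
    also have "\<dots> = \<theta> V W * c u W i" using VW finite_M[OF u] by simp
    finally show ?thesis using 1 comm[OF i VW(2,1)] VW(3) by simp
  qed
  moreover have "tableau_le leL leM (l, V) (u, W)" using lu by (simp add: tableau_le_def)
  ultimately show False
    using sep[unfolded separation_condition_def] VW l u lu by fastforce
qed

text \<open>
  By \<open>rep_own_basis\<close>, the assumption on \<open>v\<close> says that \<open>v\<close> is in the radical of the Gram form. If \<open>v\<close>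
  were nonzero, a minimal cell \<open>u\<close> that does not kill \<open>v\<close> would give a nonzero homomorphism from
  the cell module of \<open>u\<close> to that of \<open>l\<close>, with \<open>l < u\<close>.
\<close>

lemma gram_nondegenerate:
  assumes sep: "separation_condition \<Lambda> leL M leM m c"
    and l: "l \<in> \<Lambda>"
    and v: "\<And>S T. S \<in> M l \<Longrightarrow> T \<in> M l \<Longrightarrow> act l (C l S T) v S = 0"
    and U: "U \<in> M l"
  shows "v U = 0"
proof (rule ccontr)
  assume vU: "v U \<noteq> 0"
  define X where "X = {u\<in>\<Lambda>. \<exists>S\<in>M u. \<exists>T\<in>M u. \<exists>W\<in>M l. act l (C u S T) v W \<noteq> 0}"
  have "act l 1 v U = (\<Sum>V\<in>M l. if V = U then v U else 0)"
    unfolding act_def by (rule sum.cong) (use l U in \<open>auto simp: rep_1\<close>)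
  then have "act l 1 v U \<noteq> 0" using vU U finite_M[OF l] by simp
  then have "act l (\<Sum>(u, S, T)\<in>idx. coord 1 u S T *s C u S T) v U \<noteq> 0"
    by (simp only: coord_expand[symmetric] simp_thms)
  then have "(\<Sum>(u, S, T)\<in>idx. coord 1 u S T * act l (C u S T) v U) \<noteq> 0"
    using l U by (simp add: act_linear case_prod_unfold)
  then obtain u S T where "(u, S, T) \<in> idx" "act l (C u S T) v U \<noteq> 0"
    by (auto elim!: sum.not_neutral_contains_not_neutral)
  then have "X \<noteq> {}" using U by (auto simp: X_def)
  moreover have "finite X" using finite_Lambda by (auto simp: X_def)
  ultimately obtain u where u: "u \<in> X" "\<And>u'. u' \<in> X \<Longrightarrow> (u', u) \<in> leL \<Longrightarrow> u' = u"
    using finite_poset_extremal(1)[OF order_Lambda] by meson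
  then obtain S T W where STW: "u \<in> \<Lambda>" "S \<in> M u" "T \<in> M u" "W \<in> M l" "act l (C u S T) v W \<noteq> 0"
    by (auto simp: X_def)
  \<comment> \<open>The cell \<open>l\<close> itself kills \<open>v\<close>, also in the rows other than \<open>S\<close>, where \<open>C l S T\<close> has only zeros.\<close>
  have "l \<noteq> u"
  proof
    assume [simp]: "l = u"
    have "act l (C l S T) v W = 0"
    proof (cases "W = S")
      case True then show ?thesis using v STW by auto
    next
      case False
      then show ?thesis
        unfolding act_def using rep_own_basis[of l S T W _ S] STW by simp
    qed
    then show False using STW by simp
  qed
  obtain V where "V \<in> M l" "rep l (C u S T) W V \<noteq> 0"
    using STW(5) unfolding act_def by (auto elim!: sum.not_neutral_contains_not_neutral)
  then have lu: "(l, u) \<in> leL" using rep_basis_le STW l by blast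
  have low: "act l y v V = 0" if "y \<in> lower u" "V \<in> M l" for y V
  proof -
    have "y \<in> {y. act l y v V = 0}"
      using that(1) unfolding cell_lower_def
    proof (rule span_subspace_induct)
      show "subspace {y. act l y v V = 0}"
        using that l by (auto simp: subspace_def act_linear)
    next
      fix x assume "x \<in> {C w S T |w S T. w \<in> \<Lambda> \<and> (w, u) \<in> leL \<and> w \<noteq> u \<and> S \<in> M w \<and> T \<in> M w}"
      then show "x \<in> {y. act l y v V = 0}" using u(2) that(2) unfolding X_def by blast
    qed
    then show ?thesis by simp
  qed
  define \<theta> where "\<theta> = (\<lambda>V S. act l (C u S T) v V)"
  have "\<theta> W S = 0"
  proof (rule intertwiner_eq_0[OF sep l STW(1) lu \<open>l \<noteq> u\<close> _ STW(2,4)])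
    fix i S S' assume i: "i \<in> {1..m}" and S: "S \<in> M u" "S' \<in> M l"
    define y where "y = L i * C u S T - (\<Sum>V\<in>M u. rep u (L i) V S *s C u V T)"
    have y: "y \<in> lower u" unfolding y_def by (intro rep_cong STW S)
    have "(\<Sum>V\<in>M l. rep l (L i) S' V * \<theta> V S) = act l (L i * C u S T) v S'"
      using l S by (simp add: act_mult \<theta>_def) (simp add: act_def)
    also have "L i * C u S T = y + (\<Sum>V\<in>M u. rep u (L i) V S *s C u V T)" by (simp add: y_def)
    also have "act l \<dots> v S' = (\<Sum>V\<in>M u. \<theta> S' V * rep u (L i) V S)"
      using l S low[OF y] by (simp add: act_linear \<theta>_def mult.commute)
    finally show "(\<Sum>V\<in>M l. rep l (L i) S' V * \<theta> V S) = (\<Sum>V\<in>M u. \<theta> S' V * rep u (L i) V S)" .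
  qed
  then show False using STW by (simp add: \<theta>_def)
qed

text \<open>
  Only cells that are at least \<open>l\<close> act on the cell module of \<open>l\<close>. For \<open>l\<close> maximal in the support of \<open>a\<close>,
  each row of coefficients of \<open>a\<close> in \<open>l\<close> is therefore in the radical of the Gram form.
\<close>

lemma rep_faithful:
  assumes sep: "separation_condition \<Lambda> leL M leM m c"
    and a: "\<And>l S T. (l, S, T) \<in> idx \<Longrightarrow> rep l a S T = 0"
  shows "a = 0"
proof -
  have "coord a l S T = 0" if "(l, S, T) \<in> idx" for l S T
  proof (rule ccontr)
    assume ne: "coord a l S T \<noteq> 0"
    define X where "X = {l. \<exists>S T. (l, S, T) \<in> idx \<and> coord a l S T \<noteq> 0}"
    have "finite X" "X \<noteq> {}"
      using finite_Lambda that ne by (auto simp: X_def intro: rev_finite_subset)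
    then obtain l where l: "l \<in> X" "\<And>u. u \<in> X \<Longrightarrow> (l, u) \<in> leL \<Longrightarrow> u = l"
      using finite_poset_extremal(2)[OF order_Lambda] by meson
    then obtain S T where ST: "l \<in> \<Lambda>" "S \<in> M l" "T \<in> M l" "coord a l S T \<noteq> 0"
      by (auto simp: X_def)
    have "coord a l S T = 0"
    proof (rule gram_nondegenerate[OF sep ST(1) _ ST(3), of "coord a l S"])
      fix V U assume VU: "V \<in> M l" "U \<in> M l"
      have "0 = rep l (\<Sum>(u, S', T')\<in>idx. coord a u S' T' *s C u S' T') S U"
        using a[of l S U] ST VU by (simp only: coord_expand[symmetric] mem_idx)
      also have "\<dots> = (\<Sum>(u, S', T')\<in>idx. coord a u S' T' * rep l (C u S' T') S U)"
        using ST VU by (simp add: rep_sum rep_scale case_prod_unfold)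
      also have "\<dots> = (\<Sum>(u, S', T')\<in>(\<lambda>T. (l, S, T)) ` M l. coord a u S' T' * rep l (C u S' T') S U)"
      proof (rule sum.mono_neutral_right[OF finite_idx])
        show "(\<lambda>T. (l, S, T)) ` M l \<subseteq> idx" using ST by auto
        show "\<forall>x\<in>idx - (\<lambda>T. (l, S, T)) ` M l.
            (case x of (u, S', T') \<Rightarrow> coord a u S' T' * rep l (C u S' T') S U) = 0"
        proof clarify
          fix u S' T' assume x: "(u, S', T') \<in> idx" "(u, S', T') \<notin> (\<lambda>T. (l, S, T)) ` M l"
          show "coord a u S' T' * rep l (C u S' T') S U = 0"
          proof (rule ccontr)
            assume "coord a u S' T' * rep l (C u S' T') S U \<noteq> 0"
            then have nz: "coord a u S' T' \<noteq> 0" "rep l (C u S' T') S U \<noteq> 0" by auto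
            then have "u = l" using l(2)[of u] rep_basis_le[of u S' T' l S U] x(1) ST VU
              by (auto simp: X_def)
            then show False using nz(2) rep_own_basis[of l S' T' S U S] x ST VU
              by (auto split: if_splits)
          qed
        qed
      qed
      also have "\<dots> = (\<Sum>T\<in>M l. coord a l S T * rep l (C l S T) S U)"
        by (subst sum.reindex) (auto simp: inj_on_def)
      also have "\<dots> = act l (C l V U) (coord a l S) V"
        unfolding act_def
      proof (rule sum.cong[OF refl])
        fix T assume T: "T \<in> M l"
        show "coord a l S T * rep l (C l S T) S U = rep l (C l V U) V T * coord a l S T"
          using rep_own_basis[of l S T S U V] ST VU T by simp
      qed
      finally show "act l (C l V U) (coord a l S) V = 0" by simp
    qed
    then show False using ST by simp
  qed
  then show ?thesis by (subst coord_expand) (auto intro: sum.neutral)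
qed

end

section \<open>Symmetric polynomials separate multisets of points\<close>

text \<open>
  Both polynomials and the elements of \<open>pair_ring\<close> are finitely supported functions, and most
  identities between them are additive in each argument, so that they need only be checked on
  functions with a one-element support.
\<close>

lemma poly_mapping_additive_induct [case_names zero single add]:
  fixes P :: "('b \<Rightarrow>\<^sub>0 'k::comm_monoid_add) \<Rightarrow> bool"
  assumes "P 0" "\<And>x n. P (Poly_Mapping.single x n)" "\<And>f g. P f \<Longrightarrow> P g \<Longrightarrow> P (f + g)"
  shows "P f"
proof -
  have P_sum: "P (\<Sum>x\<in>X. Poly_Mapping.single x (h x))" for X h
    by (induction X rule: infinite_finite_induct) (use assms in auto)
  have "f = (\<Sum>x\<in>Poly_Mapping.keys f. Poly_Mapping.single x (Poly_Mapping.lookup f x))"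
    by (rule poly_mapping_eqI)
      (auto simp: lookup_sum lookup_single when_def in_keys_iff)
  then show ?thesis using P_sum by metis
qed

definition poly_eval :: "nat \<Rightarrow> (nat \<Rightarrow> 'k::comm_ring_1) \<Rightarrow> ((nat \<Rightarrow>\<^sub>0 nat) \<Rightarrow>\<^sub>0 'k) \<Rightarrow> 'k" where
  "poly_eval m x p = (\<Sum>e\<in>Poly_Mapping.keys p.
     Poly_Mapping.lookup p e * (\<Prod>i\<in>{1..m}. x i ^ Poly_Mapping.lookup e i))"

lemma poly_eval_single:
  "poly_eval m x (Poly_Mapping.single e k) = k * (\<Prod>i\<in>{1..m}. x i ^ Poly_Mapping.lookup e i)"
  by (simp add: poly_eval_def)

lemma poly_eval_0: "poly_eval m x 0 = 0"
  by (simp add: poly_eval_def)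

lemma poly_eval_add: "poly_eval m x (p + q) = poly_eval m x p + poly_eval m x q"
  unfolding poly_eval_def by (rule setsum_keys_plus_distrib) (auto simp: distrib_right)

lemma poly_eval_sum: "poly_eval m x (\<Sum>i\<in>I. f i) = (\<Sum>i\<in>I. poly_eval m x (f i))"
  by (induction I rule: infinite_finite_induct) (auto simp: poly_eval_0 poly_eval_add)

lemma poly_eval_mult: "poly_eval m x (p * q) = poly_eval m x p * poly_eval m x q"
proof (induction p rule: poly_mapping_additive_induct)
  case (single e k)
  show ?case
    by (induction q rule: poly_mapping_additive_induct)
      (auto simp: mult_single poly_eval_single poly_eval_0 poly_eval_add distrib_left
        lookup_add power_add prod.distrib distrib_right mult_ac)
qed (auto simp: poly_eval_0 poly_eval_add distrib_right)

lemma poly_eval_1: "poly_eval m x 1 = 1"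
  using poly_eval_single[of m x 0 1] by (simp del: single_one add: single_one[symmetric])

lemma poly_eval_prod: "poly_eval m x (\<Prod>i\<in>I. f i) = (\<Prod>i\<in>I. poly_eval m x (f i))"
  by (induction I rule: infinite_finite_induct) (auto simp: poly_eval_1 poly_eval_mult)

text \<open>
  The polynomial \<open>permute_vars \<sigma> p\<close> arises from \<open>p\<close> by substituting the variable with index
  \<open>\<sigma> i\<close> for the one with index \<open>i\<close>. Symmetric polynomials are its fixed points, which makes
  closure under products a consequence of \<open>permute_vars\<close> being multiplicative.
\<close>

definition permute_vars :: "(nat \<Rightarrow> nat) \<Rightarrow> ((nat \<Rightarrow>\<^sub>0 nat) \<Rightarrow>\<^sub>0 'k::zero) \<Rightarrow> ((nat \<Rightarrow>\<^sub>0 nat) \<Rightarrow>\<^sub>0 'k)" where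
  "permute_vars \<sigma> = Poly_Mapping.map_key (Poly_Mapping.map_key \<sigma>)"

context
  fixes \<sigma> :: "nat \<Rightarrow> nat"
  assumes bij: "bij \<sigma>"
begin

lemma lookup_map_key_exponent:
  "Poly_Mapping.lookup (Poly_Mapping.map_key \<sigma> e) i = Poly_Mapping.lookup e (\<sigma> i)"
  by (simp add: map_key.rep_eq[OF bij_is_inj[OF bij]])

lemma bij_map_key_exponent: "bij (Poly_Mapping.map_key \<sigma> :: (nat \<Rightarrow>\<^sub>0 nat) \<Rightarrow> _)"
proof (rule bijI)
  show "inj (Poly_Mapping.map_key \<sigma> :: (nat \<Rightarrow>\<^sub>0 nat) \<Rightarrow> _)"
  proof (rule injI)
    fix e f :: "nat \<Rightarrow>\<^sub>0 nat" assume eq: "Poly_Mapping.map_key \<sigma> e = Poly_Mapping.map_key \<sigma> f"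
    show "e = f"
    proof (rule poly_mapping_eqI)
      fix k
      show "Poly_Mapping.lookup e k = Poly_Mapping.lookup f k"
        using lookup_map_key_exponent[of e "inv_into UNIV \<sigma> k"] lookup_map_key_exponent[of f "inv_into UNIV \<sigma> k"] eq
        by (simp add: surj_f_inv_f[OF bij_is_surj[OF bij]])
    qed
  qed
  have "e = Poly_Mapping.map_key \<sigma> (Poly_Mapping.map_key (inv_into UNIV \<sigma>) e)" for e :: "nat \<Rightarrow>\<^sub>0 nat"
    using bij_is_inj[OF bij] bij_is_inj[OF bij_imp_bij_inv[OF bij]]
    by (simp add: map_key_compose inv_o_cancel o_def map_key_id inv_f_f)
  then show "surj (Poly_Mapping.map_key \<sigma> :: (nat \<Rightarrow>\<^sub>0 nat) \<Rightarrow> _)" by (rule surjI[OF sym])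
qed

lemma lookup_permute_vars:
  "Poly_Mapping.lookup (permute_vars \<sigma> p) e = Poly_Mapping.lookup p (Poly_Mapping.map_key \<sigma> e)"
  unfolding permute_vars_def by (simp add: map_key.rep_eq[OF bij_is_inj[OF bij_map_key_exponent]])

lemma permute_vars_single:
  "permute_vars \<sigma> (Poly_Mapping.single (Poly_Mapping.map_key \<sigma> e) k) = Poly_Mapping.single e k"
  unfolding permute_vars_def by (rule map_key_single[OF bij_is_inj[OF bij_map_key_exponent]])

lemma permute_vars_0: "permute_vars \<sigma> 0 = 0"
  unfolding permute_vars_def by (rule map_key_zero[OF bij_is_inj[OF bij_map_key_exponent]])

lemma permute_vars_add:
  "permute_vars \<sigma> (p + q) = permute_vars \<sigma> p + permute_vars \<sigma> (q :: (nat \<Rightarrow>\<^sub>0 nat) \<Rightarrow>\<^sub>0 'k::comm_ring_1)"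
  unfolding permute_vars_def by (rule map_key_plus[OF bij_is_inj[OF bij_map_key_exponent]])

lemma exponent_cases: obtains d where "e = Poly_Mapping.map_key \<sigma> (d :: nat \<Rightarrow>\<^sub>0 nat)"
  using surjD[OF bij_is_surj[OF bij_map_key_exponent], of e] that by blast

lemma permute_vars_mult:
  "permute_vars \<sigma> (p * q) = permute_vars \<sigma> p * permute_vars \<sigma> (q :: (nat \<Rightarrow>\<^sub>0 nat) \<Rightarrow>\<^sub>0 'k::comm_ring_1)"
proof (induction p rule: poly_mapping_additive_induct)
  case (single e k)
  obtain e' where e: "e = Poly_Mapping.map_key \<sigma> e'" by (rule exponent_cases)
  show ?case
  proof (induction q rule: poly_mapping_additive_induct)
    case (single d h)
    obtain d' where d: "d = Poly_Mapping.map_key \<sigma> d'" by (rule exponent_cases)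
    show ?case
      by (simp add: e d mult_single permute_vars_single map_key_plus[OF bij_is_inj[OF bij], symmetric])
  qed (auto simp: permute_vars_0 permute_vars_add distrib_left)
qed (auto simp: permute_vars_0 permute_vars_add distrib_right)

lemma poly_eval_permute_vars:
  assumes "\<sigma> permutes {1..m}"
  shows "poly_eval m x (permute_vars \<sigma> p) = poly_eval m (x \<circ> \<sigma>) (p :: (nat \<Rightarrow>\<^sub>0 nat) \<Rightarrow>\<^sub>0 'k::comm_ring_1)"
proof (induction p rule: poly_mapping_additive_induct)
  case (single e k)
  obtain d where e: "e = Poly_Mapping.map_key \<sigma> d" by (rule exponent_cases)
  have "(\<Prod>i\<in>{1..m}. x i ^ Poly_Mapping.lookup d i) =
      (\<Prod>i\<in>{1..m}. x (\<sigma> i) ^ Poly_Mapping.lookup d (\<sigma> i))"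
    using prod.permute[OF assms, of "\<lambda>i. x i ^ Poly_Mapping.lookup d i"] by (simp add: o_def)
  then show ?case
    by (simp add: e permute_vars_single poly_eval_single lookup_map_key_exponent)
qed (auto simp: poly_eval_0 permute_vars_0 permute_vars_add poly_eval_add)

end

lemma symmetric_polys_iff:
  "p \<in> symmetric_polys m \<longleftrightarrow> (\<forall>e\<in>Poly_Mapping.keys p. Poly_Mapping.keys e \<subseteq> {1..m}) \<and>
    (\<forall>\<sigma>. \<sigma> permutes {1..m} \<longrightarrow> permute_vars \<sigma> p = p)"
  unfolding symmetric_polys_def
  by (auto simp: lookup_permute_vars[OF permutes_bij] poly_mapping_eq_iff fun_eq_iff)

lemma poly_eval_symmetric_permute:
  assumes "p \<in> symmetric_polys m" "\<sigma> permutes {1..m}" "\<forall>i\<in>{1..m}. x i = y (\<sigma> i)"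
  shows "poly_eval m x p = poly_eval m y p"
proof -
  have "poly_eval m x p = poly_eval m (y \<circ> \<sigma>) p"
    using assms(3) by (simp add: poly_eval_def)
  also have "\<dots> = poly_eval m y (permute_vars \<sigma> p)"
    using poly_eval_permute_vars[OF permutes_bij[OF assms(2)] assms(2)] by metis
  finally show ?thesis using assms by (simp add: symmetric_polys_iff)
qed

lemma symmetric_single_0: "Poly_Mapping.single 0 k \<in> symmetric_polys m" for k :: "'k::comm_ring_1"
proof -
  have "permute_vars \<sigma> (Poly_Mapping.single 0 k) = Poly_Mapping.single 0 k" if "\<sigma> permutes {1..m}" for \<sigma>
    using permute_vars_single[OF permutes_bij[OF that], of 0 k]
    by (simp add: map_key_zero[OF permutes_inj[OF that]])
  then show ?thesis by (auto simp: symmetric_polys_iff)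
qed

lemma symmetric_add:
  fixes p q :: "(nat \<Rightarrow>\<^sub>0 nat) \<Rightarrow>\<^sub>0 'k::comm_ring_1"
  assumes "p \<in> symmetric_polys m" "q \<in> symmetric_polys m"
  shows "p + q \<in> symmetric_polys m"
  unfolding symmetric_polys_iff
proof (intro conjI ballI allI impI)
  show "Poly_Mapping.keys e \<subseteq> {1..m}" if "e \<in> Poly_Mapping.keys (p + q)" for e
    using that keys_add[of p q] assms unfolding symmetric_polys_iff by blast
  show "permute_vars \<sigma> (p + q) = p + q" if "\<sigma> permutes {1..m}" for \<sigma>
    using assms that by (simp add: symmetric_polys_iff permute_vars_add[OF permutes_bij])
qed

lemma symmetric_mult:
  fixes p q :: "(nat \<Rightarrow>\<^sub>0 nat) \<Rightarrow>\<^sub>0 'k::comm_ring_1"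
  assumes "p \<in> symmetric_polys m" "q \<in> symmetric_polys m"
  shows "p * q \<in> symmetric_polys m"
proof -
  have "Poly_Mapping.keys e \<subseteq> {1..m}" if e: "e \<in> Poly_Mapping.keys (p * q)" for e
  proof -
    obtain a b where ab: "e = a + b" "a \<in> Poly_Mapping.keys p" "b \<in> Poly_Mapping.keys q"
      using keys_mult[of p q] e by blast
    then show ?thesis using assms keys_add[of a b] unfolding symmetric_polys_iff by blast
  qed
  then show ?thesis
    using assms by (auto simp: symmetric_polys_iff permute_vars_mult[OF permutes_bij])
qed

lemma symmetric_sum:
  fixes f :: "'i \<Rightarrow> (nat \<Rightarrow>\<^sub>0 nat) \<Rightarrow>\<^sub>0 'k::comm_ring_1"
  shows "(\<And>i. i \<in> I \<Longrightarrow> f i \<in> symmetric_polys m) \<Longrightarrow> (\<Sum>i\<in>I. f i) \<in> symmetric_polys m"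
  by (induction I rule: infinite_finite_induct) (use symmetric_single_0[of 0] in \<open>auto intro: symmetric_add\<close>)

lemma symmetric_prod:
  fixes f :: "'i \<Rightarrow> (nat \<Rightarrow>\<^sub>0 nat) \<Rightarrow>\<^sub>0 'k::comm_ring_1"
  shows "(\<And>i. i \<in> I \<Longrightarrow> f i \<in> symmetric_polys m) \<Longrightarrow> (\<Prod>i\<in>I. f i) \<in> symmetric_polys m"
  by (induction I rule: infinite_finite_induct) (use symmetric_single_0[of 1] in \<open>auto intro: symmetric_mult\<close>)

definition squarefree_exponent :: "nat set \<Rightarrow> (nat \<Rightarrow>\<^sub>0 nat)" where
  "squarefree_exponent X = (\<Sum>i\<in>X. Poly_Mapping.single i 1)"

lemma lookup_squarefree_exponent:
  "finite X \<Longrightarrow> Poly_Mapping.lookup (squarefree_exponent X) i = (if i \<in> X then 1 else 0)"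
  by (simp add: squarefree_exponent_def lookup_sum lookup_single when_def)

definition elementary_symmetric :: "nat \<Rightarrow> nat \<Rightarrow> ((nat \<Rightarrow>\<^sub>0 nat) \<Rightarrow>\<^sub>0 'k::comm_ring_1)" where
  "elementary_symmetric m k =
     (\<Sum>X | X \<subseteq> {1..m} \<and> card X = k. Poly_Mapping.single (squarefree_exponent X) 1)"

lemma elementary_symmetric_in:
  "(elementary_symmetric m k :: (nat \<Rightarrow>\<^sub>0 nat) \<Rightarrow>\<^sub>0 'k::comm_ring_1) \<in> symmetric_polys m"
  unfolding symmetric_polys_iff
proof (intro conjI ballI allI impI)
  let ?A = "{X. X \<subseteq> {1..m} \<and> card X = k}"
  have fin: "finite X" if "X \<in> ?A" for X using that by (auto intro: finite_subset)
  fix e assume "e \<in> Poly_Mapping.keys (elementary_symmetric m k :: (nat \<Rightarrow>\<^sub>0 nat) \<Rightarrow>\<^sub>0 'k)"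
  then have "(\<Sum>X\<in>?A. (1::'k) when squarefree_exponent X = e) \<noteq> 0"
    by (simp add: elementary_symmetric_def in_keys_iff lookup_sum lookup_single)
  then obtain X where "X \<in> ?A" "squarefree_exponent X = e"
    by (auto elim!: sum.not_neutral_contains_not_neutral split: if_splits simp: when_def)
  then show "Poly_Mapping.keys e \<subseteq> {1..m}"
    using fin[of X] by (auto simp: in_keys_iff lookup_squarefree_exponent split: if_splits)
next
  fix \<sigma> assume \<sigma>: "\<sigma> permutes {1..m}"
  note b = permutes_bij[OF \<sigma>]
  let ?A = "{X. X \<subseteq> {1..m} \<and> card X = k}"
  have fin: "finite X" if "X \<in> ?A" for X using that by (auto intro: finite_subset)
  have pv: "permute_vars \<sigma> (Poly_Mapping.single (squarefree_exponent X) (1::'k)) =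
      Poly_Mapping.single (squarefree_exponent (\<sigma> ` X)) 1" if "X \<in> ?A" for X
  proof -
    have "squarefree_exponent X = Poly_Mapping.map_key \<sigma> (squarefree_exponent (\<sigma> ` X))"
      by (rule poly_mapping_eqI)
        (use fin[OF that] permutes_inj[OF \<sigma>] in \<open>auto simp: lookup_map_key_exponent[OF b]
          lookup_squarefree_exponent inj_image_mem_iff\<close>)
    then show ?thesis using permute_vars_single[OF b, of "squarefree_exponent (\<sigma> ` X)" "1::'k"] by simp
  qed
  show "permute_vars \<sigma> (elementary_symmetric m k :: (nat \<Rightarrow>\<^sub>0 nat) \<Rightarrow>\<^sub>0 'k) = elementary_symmetric m k"
  proof -
    have "permute_vars \<sigma> (\<Sum>X\<in>B. Poly_Mapping.single (squarefree_exponent X) (1::'k)) =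
        (\<Sum>X\<in>B. permute_vars \<sigma> (Poly_Mapping.single (squarefree_exponent X) 1))" for B
      by (induction B rule: infinite_finite_induct) (auto simp: permute_vars_0[OF b] permute_vars_add[OF b])
    then have "permute_vars \<sigma> (elementary_symmetric m k :: (nat \<Rightarrow>\<^sub>0 nat) \<Rightarrow>\<^sub>0 'k) =
        (\<Sum>X\<in>?A. Poly_Mapping.single (squarefree_exponent (\<sigma> ` X)) 1)"
      unfolding elementary_symmetric_def using pv by simp
    also have "\<dots> = elementary_symmetric m k"
      unfolding elementary_symmetric_def
    proof (rule sum.reindex_bij_betw)
      have inj: "inj_on \<sigma> X" for X using permutes_inj[OF \<sigma>] by (rule inj_on_subset) simp
      show "bij_betw ((`) \<sigma>) ?A ?A"
      proof (rule bij_betwI[where g = "(`) (inv_into UNIV \<sigma>)"])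
        show "(`) \<sigma> \<in> ?A \<rightarrow> ?A"
          using permutes_image[OF \<sigma>] inj by (auto simp: card_image)
        have "inj_on (inv_into UNIV \<sigma>) X" for X
          using permutes_inj[OF permutes_inv[OF \<sigma>]] by (rule inj_on_subset) simp
        then show "(`) (inv_into UNIV \<sigma>) \<in> ?A \<rightarrow> ?A"
          using permutes_image[OF permutes_inv[OF \<sigma>]] by (auto simp: card_image)
      qed (use permutes_inverses[OF \<sigma>] in \<open>auto simp: image_image\<close>)
    qed
    finally show ?thesis .
  qed
qed

lemma poly_eval_elementary_symmetric:
  "poly_eval m x (elementary_symmetric m k) = (\<Sum>X | X \<subseteq> {1..m} \<and> card X = k. \<Prod>i\<in>X. x i)"
  unfolding elementary_symmetric_def poly_eval_sum
proof (rule sum.cong[OF refl])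
  fix X assume X: "X \<in> {X. X \<subseteq> {1..m} \<and> card X = k}"
  then have "finite X" by (auto intro: finite_subset)
  then have "(\<Prod>i\<in>{1..m}. x i ^ Poly_Mapping.lookup (squarefree_exponent X) i) =
      (\<Prod>i\<in>{1..m}. if i \<in> X then x i else 1)"
    by (intro prod.cong) (auto simp: lookup_squarefree_exponent)
  also have "\<dots> = (\<Prod>i\<in>X. x i)"
    using X by (simp add: prod.If_cases Int_absorb1)
  finally show "poly_eval m x (Poly_Mapping.single (squarefree_exponent X) 1) = (\<Prod>i\<in>X. x i)"
    by (simp add: poly_eval_single)
qed

text \<open>
  Vieta's formula: the values of the elementary symmetric polynomials at \<open>x\<close> are the coefficients
  of a polynomial whose roots are the \<open>- x i\<close>.
\<close>

lemma prod_linear_factors: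
  "(\<Prod>i\<in>{1..m}. [:x i, 1:]) = (\<Sum>k\<le>m. monom (poly_eval m x (elementary_symmetric m k)) (m - k))"
proof -
  have "(\<Prod>i\<in>{1..m}. [:x i, 1:]) = (\<Prod>i\<in>{1..m}. [:x i:] + [:0, 1:])" by simp
  also have "\<dots> = (\<Sum>X\<in>Pow {1..m}. monom (\<Prod>i\<in>X. x i) (m - card X))"
    unfolding prod_add[OF finite_atLeastAtMost]
  proof (rule sum.cong[OF refl])
    fix X assume X: "X \<in> Pow {1..m}"
    then have "finite X" by (auto intro: finite_subset)
    then have "card ({1..m} - X) = m - card X" using X by (simp add: card_Diff_subset)
    moreover have "(\<Prod>i\<in>X. [:x i:]) = [:\<Prod>i\<in>X. x i:]"
      by (induction X rule: infinite_finite_induct) auto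
    ultimately show "(\<Prod>i\<in>X. [:x i:]) * (\<Prod>i\<in>{1..m} - X. [:0, 1:]) = monom (\<Prod>i\<in>X. x i) (m - card X)"
      by (simp add: monom_altdef)
  qed
  also have "\<dots> = (\<Sum>k\<in>{..m}. \<Sum>X\<in>{X \<in> Pow {1..m}. card X = k}. monom (\<Prod>i\<in>X. x i) (m - card X))"
  proof (rule sum.group[symmetric])
    show "card ` Pow {1..m} \<subseteq> {..m}" using card_mono[of "{1..m}"] by auto
  qed auto
  also have "\<dots> = (\<Sum>k\<le>m. monom (poly_eval m x (elementary_symmetric m k)) (m - k))"
    by (intro sum.cong refl)
      (auto simp: poly_eval_elementary_symmetric monom_sum intro!: sum.cong)
  finally show ?thesis .
qed

text \<open>
  If all elementary symmetric polynomials agree at \<open>x\<close> and \<open>y\<close>, then the polynomials with roots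
  \<open>- x i\<close> and \<open>- y i\<close> are equal, so the multisets of coordinates are.
\<close>

lemma symmetric_separates:
  fixes x y :: "nat \<Rightarrow> 'k::field"
  assumes "\<not> (\<exists>\<sigma>. \<sigma> permutes {1..m} \<and> (\<forall>i\<in>{1..m}. x i = y (\<sigma> i)))"
  shows "\<exists>p\<in>symmetric_polys m. poly_eval m x p \<noteq> poly_eval m y p"
proof (rule ccontr)
  assume "\<not> ?thesis"
  then have "poly_eval m x (elementary_symmetric m k) = poly_eval m y (elementary_symmetric m k)" for k
    using elementary_symmetric_in by blast
  then have "proots (\<Prod>i\<in>{1..m}. [:x i, 1:]) = proots (\<Prod>i\<in>{1..m}. [:y i, 1:])"
    by (simp only: prod_linear_factors)
  then have "(\<Sum>i\<in>{1..m}. {#- x i#}) = (\<Sum>i\<in>{1..m}. {#- y i#})"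
    by (simp add: proots_prod)
  moreover have "(\<Sum>i\<in>A. {#- z i#}) = image_mset (\<lambda>i. - z i) (mset_set A)"
    for z :: "nat \<Rightarrow> 'k" and A
    by (induction A rule: infinite_finite_induct) auto
  ultimately have "image_mset uminus (image_mset (\<lambda>i. - x i) (mset_set {1..m})) =
      image_mset uminus (image_mset (\<lambda>i. - y i) (mset_set {1..m}))"
    by (simp only:)
  then have "image_mset x (mset_set {1..m}) = image_mset y (mset_set {1..m})"
    by (simp add: multiset.map_comp o_def)
  from image_mset_eq_implies_permutes[OF finite_atLeastAtMost this] assms show False by blast
qed

text \<open>
  As for Lagrange interpolation: an affine change of a separating polynomial takes the values \<open>1\<close>
  and \<open>0\<close> at two given points, and products of these are indicators of single points.
\<close>

lemma symmetric_interpolation: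
  fixes x :: "'i \<Rightarrow> nat \<Rightarrow> 'k::field"
  assumes "finite I"
    and sep: "\<And>i j. i \<in> I \<Longrightarrow> j \<in> I \<Longrightarrow> i \<noteq> j \<Longrightarrow>
      \<not> (\<exists>\<sigma>. \<sigma> permutes {1..m} \<and> (\<forall>n\<in>{1..m}. x i n = x j (\<sigma> n)))"
  shows "\<exists>p\<in>symmetric_polys m. \<forall>i\<in>I. poly_eval m (x i) p = w i"
proof -
  have "\<exists>q\<in>symmetric_polys m. poly_eval m (x i) q = 1 \<and> poly_eval m (x j) q = 0"
    if ij: "i \<in> I" "j \<in> I" "i \<noteq> j" for i j
  proof -
    obtain p where p: "p \<in> symmetric_polys m" "poly_eval m (x i) p \<noteq> poly_eval m (x j) p"
      using symmetric_separates[OF sep[OF ij]] by blast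
    let ?a = "poly_eval m (x i) p" and ?b = "poly_eval m (x j) p"
    have "(p + Poly_Mapping.single 0 (- ?b)) * Poly_Mapping.single 0 (1 / (?a - ?b)) \<in> symmetric_polys m"
      by (intro symmetric_mult symmetric_add symmetric_single_0 p)
    then show ?thesis
      using p(2) by (intro bexI) (auto simp: poly_eval_mult poly_eval_add poly_eval_single)
  qed
  then obtain q where q: "\<And>i j. i \<in> I \<Longrightarrow> j \<in> I \<Longrightarrow> i \<noteq> j \<Longrightarrow>
      q i j \<in> symmetric_polys m \<and> poly_eval m (x i) (q i j) = 1 \<and> poly_eval m (x j) (q i j) = 0"
    by metis
  define p where "p = (\<Sum>i\<in>I. Poly_Mapping.single 0 (w i) * (\<Prod>j\<in>I - {i}. q i j))"
  have "p \<in> symmetric_polys m"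
    unfolding p_def by (intro symmetric_sum symmetric_mult symmetric_prod symmetric_single_0) (use q in auto)
  moreover have "poly_eval m (x j) p = w j" if j: "j \<in> I" for j
  proof -
    have "poly_eval m (x j) p = (\<Sum>i\<in>I. if i = j then w j else 0)"
      unfolding p_def poly_eval_sum
    proof (rule sum.cong[OF refl])
      fix i assume i: "i \<in> I"
      show "poly_eval m (x j) (Poly_Mapping.single 0 (w i) * (\<Prod>j\<in>I - {i}. q i j)) = (if i = j then w j else 0)"
      proof (cases "i = j")
        case True
        have "(\<Prod>k\<in>I - {i}. poly_eval m (x i) (q i k)) = 1"
          using q i by (intro prod.neutral) auto
        then show ?thesis using True by (simp add: poly_eval_mult poly_eval_single poly_eval_prod)
      next
        case False
        then have "(\<Prod>k\<in>I - {i}. poly_eval m (x j) (q i k)) = 0"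
          using q i j assms(1) by (intro prod_zero) auto
        then show ?thesis using False by (simp add: poly_eval_mult poly_eval_prod)
      qed
    qed
    then show ?thesis using assms(1) j by simp
  qed
  ultimately show ?thesis by blast
qed

section \<open>Linear algebra over the field of fractions\<close>

text \<open>
  The columns of an injective square matrix are independent. A vector outside their span would
  extend them to an independent family larger than the spanning set of unit vectors.
\<close>

lemma injective_square_surjective:
  fixes A :: "'i \<Rightarrow> 'i \<Rightarrow> 'k::field"
  assumes fin: "finite I"
    and inj: "\<And>v. (\<And>i. i \<in> I \<Longrightarrow> (\<Sum>j\<in>I. A i j * v j) = 0) \<Longrightarrow> (\<And>j. j \<in> I \<Longrightarrow> v j = 0)"
  shows "\<exists>v. \<forall>i\<in>I. (\<Sum>j\<in>I. A i j * v j) = w i"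
proof -
  interpret V: vector_space "\<lambda>(k::'k) (f :: 'i \<Rightarrow> 'k) x. k * f x"
    by standard (auto simp: algebra_simps fun_eq_iff)
  define unit :: "'i \<Rightarrow> 'i \<Rightarrow> 'k" where "unit j = (\<lambda>i. if i = j then 1 else 0)" for j
  define col where "col j = (\<lambda>i. if i \<in> I then A i j else 0)" for j
  define u where "u = (\<lambda>i. if i \<in> I then w i else 0)"
  have sum_fun: "(\<Sum>j\<in>J. (\<lambda>i. g j i)) = (\<lambda>i. \<Sum>j\<in>J. g j i)" for J :: "'i set" and g :: "'i \<Rightarrow> 'i \<Rightarrow> 'k"
    by (induction J rule: infinite_finite_induct) (auto simp: fun_eq_iff)
  have in_span: "f \<in> V.span (unit ` I)" if f: "\<And>i. i \<notin> I \<Longrightarrow> f i = 0" for f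
  proof -
    have "f = (\<Sum>j\<in>I. (\<lambda>i. f j * unit j i))"
      unfolding sum_fun
    proof
      fix i
      have "(\<Sum>j\<in>I. f j * unit j i) = (\<Sum>j\<in>I. if j = i then f i else 0)"
        by (rule sum.cong) (auto simp: unit_def)
      then show "f i = (\<Sum>j\<in>I. f j * unit j i)" using fin f[of i] by (simp add: sum.delta)
    qed
    moreover have "(\<Sum>j\<in>I. (\<lambda>i. f j * unit j i)) \<in> V.span (unit ` I)"
      by (intro V.span_sum V.span_scale V.span_base) auto
    ultimately show ?thesis by simp
  qed
  have indep0: "v j = 0" if "(\<Sum>j\<in>I. (\<lambda>i. v j * col j i)) = 0" "j \<in> I" for v j
  proof (rule inj[OF _ that(2)])
    fix i assume "i \<in> I"
    have "(\<Sum>j\<in>I. A i j * v j) = (\<Sum>j\<in>I. v j * col j i)"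
      using \<open>i \<in> I\<close> by (simp add: col_def mult.commute)
    also have "\<dots> = 0" using that(1) unfolding sum_fun by (simp add: fun_eq_iff)
    finally show "(\<Sum>j\<in>I. A i j * v j) = 0" .
  qed
  have inj_col: "inj_on col I"
  proof (rule inj_onI, rule ccontr)
    fix j k assume jk: "j \<in> I" "k \<in> I" "col j = col k" "j \<noteq> k"
    \<comment> \<open>The difference of two unit vectors is killed if two columns coincide.\<close>
    define v :: "'i \<Rightarrow> 'k" where "v = (\<lambda>x. (if x = j then 1 else 0) - (if x = k then 1 else 0))"
    have "v j = 0"
    proof (rule inj[OF _ jk(1)])
      fix i assume i: "i \<in> I"
      have "(\<Sum>x\<in>I. A i x * v x) = A i j - A i k"
        using jk fin by (simp add: v_def right_diff_distrib sum_subtractf if_distrib[of "\<lambda>y. _ * y"] sum.delta cong: if_cong)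
      then show "(\<Sum>x\<in>I. A i x * v x) = 0"
        using fun_cong[OF jk(3), of i] i by (simp add: col_def)
    qed
    then show False using jk by (simp add: v_def)
  qed
  have ind: "V.independent (col ` I)"
  proof
    assume "V.dependent (col ` I)"
    then obtain c v where v: "v \<in> col ` I" "c v \<noteq> 0" "(\<Sum>v\<in>col ` I. (\<lambda>x. c v * v x)) = 0"
      using V.dependent_finite[of "col ` I"] fin by auto
    have "(\<Sum>j\<in>I. (\<lambda>i. c (col j) * col j i)) = 0"
      using v(3) by (simp add: sum.reindex[OF inj_col] o_def)
    then show False using indep0[of "c \<circ> col"] v by auto
  qed
  have "u \<in> V.span (col ` I)"
  proof (rule ccontr)
    assume u: "u \<notin> V.span (col ` I)"
    then have "u \<notin> col ` I" using V.span_base by blast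
    then have "card (insert u (col ` I)) = Suc (card I)"
      using fin card_image[OF inj_col] by simp
    moreover have "insert u (col ` I) \<subseteq> V.span (unit ` I)"
      using in_span by (auto simp: u_def col_def)
    then have "card (insert u (col ` I)) \<le> card (unit ` I)"
      using V.independent_span_bound[OF _ V.independent_insertI[OF u ind]] fin by blast
    moreover have "card (unit ` I) \<le> card I" using fin by (rule card_image_le)
    ultimately show False by simp
  qed
  then obtain c where c: "u = (\<Sum>v\<in>col ` I. (\<lambda>x. c v * v x))"
    using V.span_finite[of "col ` I"] fin by auto
  have "w i = (\<Sum>j\<in>I. A i j * c (col j))" if i: "i \<in> I" for i
  proof -
    have "w i = u i" using i by (simp add: u_def)
    also have "\<dots> = (\<Sum>j\<in>I. c (col j) * col j i)"
      unfolding c sum.reindex[OF inj_col] o_def sum_fun ..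
    finally show ?thesis using i by (simp add: col_def mult.commute)
  qed
  then show ?thesis by (intro exI[of _ "\<lambda>j. c (col j)"]) auto
qed

definition emb :: "'r::idom \<Rightarrow> 'r fract" where
  "emb r = Fraction_Field.Fract r 1"

lemma emb_0: "emb 0 = 0" and emb_1: "emb 1 = 1"
  and emb_add: "emb (a + b) = emb a + emb b"
  and emb_mult: "emb (a * b) = emb a * emb b"
  and emb_eq_iff: "emb a = emb b \<longleftrightarrow> a = b"
  by (simp_all add: emb_def fract_expand eq_fract)

lemma emb_sum: "emb (\<Sum>x\<in>X. f x) = (\<Sum>x\<in>X. emb (f x))"
  by (induction X rule: infinite_finite_induct) (auto simp: emb_0 emb_add)

lemma emb_prod: "emb (\<Prod>x\<in>X. f x) = (\<Prod>x\<in>X. emb (f x))"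
  by (induction X rule: infinite_finite_induct) (auto simp: emb_1 emb_mult)

lemma emb_power: "emb (a ^ n) = emb a ^ n"
  by (induction n) (auto simp: emb_1 emb_mult)

lemma common_denominator:
  assumes "finite I"
  shows "\<exists>d x. d \<noteq> 0 \<and> (\<forall>i\<in>I. emb d * k i = emb (x i))"
  using assms
proof (induction I rule: finite_induct)
  case empty
  show ?case by (intro exI[of _ 1]) auto
next
  case (insert i I)
  then obtain d x where d: "d \<noteq> 0" "\<And>j. j \<in> I \<Longrightarrow> emb d * k j = emb (x j)" by blast
  obtain a b where ab: "k i = Fraction_Field.Fract a b" "b \<noteq> 0" by (rule Fract_cases)
  then have b: "emb b * k i = emb a" by (simp add: emb_def eq_fract)
  have "emb (b * d) * k j = emb (if j = i then d * a else b * x j)" if "j \<in> insert i I" for j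
    using b d(2)[of j] that by (auto simp: emb_mult mult_ac)
  then show ?case using d(1) ab(2)
    by (intro exI[of _ "b * d"] exI[of _ "\<lambda>j. if j = i then d * a else b * x j"]) simp
qed

section \<open>The presentation of the tensor product\<close>

abbreviation pair_mult ::
  "(('a::{ring,monoid_mult} \<times> 'k::field) \<Rightarrow>\<^sub>0 int) \<Rightarrow> (('a \<times> 'k) \<Rightarrow>\<^sub>0 int) \<Rightarrow> (('a \<times> 'k) \<Rightarrow>\<^sub>0 int)" where
  "pair_mult \<equiv> monoid.mult pair_ring"

lemma pair_mult_def:
  "pair_mult f g = (\<Sum>x\<in>Poly_Mapping.keys f. \<Sum>y\<in>Poly_Mapping.keys g.
        Poly_Mapping.single (fst x * fst y, snd x * snd y)
          (Poly_Mapping.lookup f x * Poly_Mapping.lookup g y))"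
  by (simp add: pair_ring_def)

lemma pair_mult_single:
  "pair_mult (Poly_Mapping.single (a, k) u) (Poly_Mapping.single (b, h) v) =
    Poly_Mapping.single (a * b, k * h) (u * v)"
  by (simp add: pair_mult_def)

lemma pair_mult_0: "pair_mult 0 g = 0" "pair_mult f 0 = 0"
  by (simp_all add: pair_mult_def)

lemma pair_mult_add_left: "pair_mult (f + g) h = pair_mult f h + pair_mult g h"
  unfolding pair_mult_def
  by (rule setsum_keys_plus_distrib) (auto simp: distrib_right single_add sum.distrib)

lemma pair_mult_add_right: "pair_mult h (f + g) = pair_mult h f + pair_mult h g"
  unfolding pair_mult_def sum.distrib[symmetric]
  by (intro sum.cong refl setsum_keys_plus_distrib) (auto simp: distrib_left single_add)

lemma pair_mult_assoc: "pair_mult (pair_mult f g) h = pair_mult f (pair_mult g h)"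
proof (induction f rule: poly_mapping_additive_induct)
  case (single x u)
  show ?case
  proof (induction g rule: poly_mapping_additive_induct)
    case (single y v)
    show ?case
    proof (induction h rule: poly_mapping_additive_induct)
      case (single z w)
      show ?case by (cases x, cases y, cases z) (simp add: pair_mult_single mult.assoc)
    qed (simp_all add: pair_mult_0 pair_mult_add_left pair_mult_add_right)
  qed (simp_all add: pair_mult_0 pair_mult_add_left pair_mult_add_right)
qed (simp_all add: pair_mult_0 pair_mult_add_left pair_mult_add_right)

lemma pair_mult_1:
  "pair_mult (Poly_Mapping.single (1, 1) 1) f = f" "pair_mult f (Poly_Mapping.single (1, 1) 1) = f"
proof -
  show "pair_mult (Poly_Mapping.single (1, 1) 1) f = f"
    by (induction f rule: poly_mapping_additive_induct)
      (auto simp: pair_mult_0 pair_mult_add_right pair_mult_single)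
  show "pair_mult f (Poly_Mapping.single (1, 1) 1) = f"
    by (induction f rule: poly_mapping_additive_induct)
      (auto simp: pair_mult_0 pair_mult_add_left pair_mult_single)
qed

lemma pair_ring_simps: "carrier pair_ring = UNIV" "zero pair_ring = 0" "add pair_ring = (+)"
  "one pair_ring = Poly_Mapping.single (1, 1) 1"
  by (simp_all add: pair_ring_def)

lemma ring_pair_ring: "ring (pair_ring :: (('a::{ring,monoid_mult} \<times> 'k::field) \<Rightarrow>\<^sub>0 int) ring)"
proof (rule ringI)
  show "abelian_group (pair_ring :: (('a \<times> 'k) \<Rightarrow>\<^sub>0 int) ring)"
  proof (rule abelian_groupI)
    fix x :: "('a \<times> 'k) \<Rightarrow>\<^sub>0 int"
    show "\<exists>y\<in>carrier pair_ring. y \<oplus>\<^bsub>pair_ring\<^esub> x = \<zero>\<^bsub>pair_ring\<^esub>"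
      by (intro bexI[of _ "- x"]) (auto simp: pair_ring_simps)
  qed (auto simp: pair_ring_simps add_ac)
  show "monoid (pair_ring :: (('a \<times> 'k) \<Rightarrow>\<^sub>0 int) ring)"
    by (rule monoidI) (auto simp: pair_ring_simps pair_mult_assoc pair_mult_1)
qed (auto simp: pair_ring_simps pair_mult_add_left pair_mult_add_right)

context assoc_algebra
begin

lemma subgroup_tensor_kernel: "subgroup (tensor_kernel scale) (add_monoid pair_ring)"
proof -
  interpret R: ring "pair_ring :: (('a \<times> 'r fract) \<Rightarrow>\<^sub>0 int) ring" by (rule ring_pair_ring)
  show ?thesis unfolding tensor_kernel_def
    by (rule R.add.generate_is_subgroup) (simp add: pair_ring_simps)
qed

lemma tensor_kernel_0: "0 \<in> tensor_kernel scale"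
  using subgroup.one_closed[OF subgroup_tensor_kernel] by (simp add: pair_ring_simps)

lemma tensor_kernel_add: "f \<in> tensor_kernel scale \<Longrightarrow> g \<in> tensor_kernel scale \<Longrightarrow> f + g \<in> tensor_kernel scale"
  using subgroup.m_closed[OF subgroup_tensor_kernel] by (simp add: pair_ring_simps)

lemma pair_ring_a_inv: "m_inv (add_monoid pair_ring) f = - (f :: ('a \<times> 'r fract) \<Rightarrow>\<^sub>0 int)"
proof -
  interpret R: ring "pair_ring :: (('a \<times> 'r fract) \<Rightarrow>\<^sub>0 int) ring" by (rule ring_pair_ring)
  show ?thesis using R.minus_equality[of "- f" f] by (simp add: pair_ring_simps a_inv_def)
qed

lemma tensor_kernel_uminus: "f \<in> tensor_kernel scale \<Longrightarrow> - f \<in> tensor_kernel scale"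
  using subgroup.m_inv_closed[OF subgroup_tensor_kernel, of f] unfolding pair_ring_a_inv .

lemma tensor_kernel_relations:
  "frag_of (a + b, k) - frag_of (a, k) - frag_of (b, k) \<in> tensor_kernel scale"
  "frag_of (a, k + h) - frag_of (a, k) - frag_of (a, h) \<in> tensor_kernel scale"
  "frag_of (r *s a, k) - frag_of (a, emb r * k) \<in> tensor_kernel scale"
  unfolding tensor_kernel_def tensor_relations_def Let_def emb_def
  by (rule generate.incl, blast)+

definition tensor_cong (infix "\<sim>" 50) where
  "f \<sim> g \<longleftrightarrow> f - g \<in> tensor_kernel scale"

lemma tensor_cong_refl: "f \<sim> f"
  by (simp add: tensor_cong_def tensor_kernel_0)

lemma tensor_cong_sym: "f \<sim> g \<Longrightarrow> g \<sim> f"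
  unfolding tensor_cong_def using tensor_kernel_uminus by fastforce

lemma tensor_cong_trans [trans]: "f \<sim> g \<Longrightarrow> g \<sim> h \<Longrightarrow> f \<sim> h"
  unfolding tensor_cong_def using tensor_kernel_add[of "f - g" "g - h"] by simp

lemma tensor_cong_add: "f \<sim> g \<Longrightarrow> f' \<sim> g' \<Longrightarrow> f + f' \<sim> g + g'"
  unfolding tensor_cong_def using tensor_kernel_add[of "f - g" "f' - g'"] by (simp add: algebra_simps)

lemma tensor_cong_diff: "f \<sim> g \<Longrightarrow> f' \<sim> g' \<Longrightarrow> f - f' \<sim> g - g'"
  using tensor_cong_add[of f g "- f'" "- g'"] tensor_kernel_uminus[of "f' - g'"]
  by (simp add: tensor_cong_def)

lemma tensor_cong_sum: "(\<And>x. x \<in> X \<Longrightarrow> f x \<sim> g x) \<Longrightarrow> (\<Sum>x\<in>X. f x) \<sim> (\<Sum>x\<in>X. g x)"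
  by (induction X rule: infinite_finite_induct) (auto intro: tensor_cong_refl tensor_cong_add)

lemma tensor_cong_relations:
  "frag_of (a + b, k) \<sim> frag_of (a, k) + frag_of (b, k)"
  "frag_of (a, k + h) \<sim> frag_of (a, k) + frag_of (a, h)"
  "frag_of (r *s a, k) \<sim> frag_of (a, emb r * k)"
  using tensor_kernel_relations by (simp_all add: tensor_cong_def diff_diff_eq)

lemma tensor_cong_zero: "frag_of (0, k) \<sim> 0" "frag_of (a, 0) \<sim> 0"
  using tensor_kernel_uminus[OF tensor_kernel_relations(1)[of 0 0 k]]
    tensor_kernel_uminus[OF tensor_kernel_relations(2)[of a 0 0]] by (simp_all add: tensor_cong_def)

lemma tensor_cong_lincomb: "frag_of (\<Sum>x\<in>X. r x *s a x, k) \<sim> (\<Sum>x\<in>X. frag_of (a x, emb (r x) * k))"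
proof (induction X rule: infinite_finite_induct)
  case (insert x X)
  have "frag_of (r x *s a x + (\<Sum>x\<in>X. r x *s a x), k) \<sim> frag_of (r x *s a x, k) + frag_of (\<Sum>x\<in>X. r x *s a x, k)"
    by (rule tensor_cong_relations)
  also have "\<dots> \<sim> frag_of (a x, emb (r x) * k) + (\<Sum>x\<in>X. frag_of (a x, emb (r x) * k))"
    by (intro tensor_cong_add tensor_cong_relations insert)
  finally show ?case using insert by simp
qed (auto intro: tensor_cong_zero)

text \<open>
  The integer coefficients of formal sums can be absorbed into the scalar component.
\<close>

lemma tensor_cong_single: "Poly_Mapping.single (a, k) n \<sim> frag_of (a, of_int n * k)"
proof (induction n rule: int_induct[where k = 0])
  case base
  show ?case using tensor_cong_sym[OF tensor_cong_zero(2)] by simp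
next
  case (step1 n)
  have "Poly_Mapping.single (a, k) (n + 1) = Poly_Mapping.single (a, k) n + frag_of (a, k)"
    by (simp add: single_add)
  also have "\<dots> \<sim> frag_of (a, of_int n * k) + frag_of (a, k)"
    by (intro tensor_cong_add tensor_cong_refl step1)
  also have "\<dots> \<sim> frag_of (a, of_int n * k + k)" by (rule tensor_cong_sym[OF tensor_cong_relations(2)])
  finally show ?case by (simp add: distrib_right)
next
  case (step2 n)
  have "Poly_Mapping.single (a, k) (n - 1) = Poly_Mapping.single (a, k) n - frag_of (a, k)"
    by (simp add: single_diff)
  also have "\<dots> \<sim> frag_of (a, of_int n * k) - frag_of (a, k)"
    by (intro tensor_cong_diff tensor_cong_refl step2)
  also have "\<dots> \<sim> (frag_of (a, of_int (n - 1) * k) + frag_of (a, k)) - frag_of (a, k)"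
    using tensor_cong_relations(2)[of a "of_int (n - 1) * k" k]
    by (intro tensor_cong_diff tensor_cong_refl) (simp add: algebra_simps)
  finally show ?case by simp
qed

end

section \<open>The product of the matrix algebras of the cells\<close>

context cellular_algebra
begin

text \<open>
  The product over all cells of the full matrix rings over the field of fractions. Entries
  outside the index sets are zero, so that equality of elements is equality of functions.
\<close>

definition cell_matrices :: "('l \<Rightarrow> 's \<Rightarrow> 's \<Rightarrow> 'r fract) ring" where
  "cell_matrices =
     \<lparr>carrier = {f. \<forall>l S T. (l, S, T) \<notin> idx \<longrightarrow> f l S T = 0},
      mult = (\<lambda>f g l S T. if (l, S, T) \<in> idx then \<Sum>U\<in>M l. f l S U * g l U T else 0),
      one = (\<lambda>l S T. if (l, S, T) \<in> idx \<and> S = T then 1 else 0),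
      zero = (\<lambda>l S T. 0),
      add = (\<lambda>f g l S T. f l S T + g l S T)\<rparr>"

lemma cell_matrices_simps:
  "f \<in> carrier cell_matrices \<longleftrightarrow> (\<forall>l S T. (l, S, T) \<notin> idx \<longrightarrow> f l S T = 0)"
  "(f \<otimes>\<^bsub>cell_matrices\<^esub> g) l S T = (if (l, S, T) \<in> idx then \<Sum>U\<in>M l. f l S U * g l U T else 0)"
  "\<one>\<^bsub>cell_matrices\<^esub> l S T = (if (l, S, T) \<in> idx \<and> S = T then 1 else 0)"
  "\<zero>\<^bsub>cell_matrices\<^esub> l S T = 0"
  "(f \<oplus>\<^bsub>cell_matrices\<^esub> g) l S T = f l S T + g l S T"
  by (simp_all add: cell_matrices_def)

lemma ring_cell_matrices: "ring cell_matrices"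
proof (rule ringI)
  show "abelian_group cell_matrices"
  proof (rule abelian_groupI)
    fix f assume "f \<in> carrier cell_matrices"
    then show "\<exists>g\<in>carrier cell_matrices. g \<oplus>\<^bsub>cell_matrices\<^esub> f = \<zero>\<^bsub>cell_matrices\<^esub>"
      by (intro bexI[of _ "\<lambda>l S T. - f l S T"]) (auto simp: cell_matrices_simps fun_eq_iff)
  qed (auto simp: cell_matrices_simps fun_eq_iff add_ac)
  show "monoid cell_matrices"
  proof (rule monoidI)
    fix f g h
    show "f \<otimes>\<^bsub>cell_matrices\<^esub> g \<otimes>\<^bsub>cell_matrices\<^esub> h = f \<otimes>\<^bsub>cell_matrices\<^esub> (g \<otimes>\<^bsub>cell_matrices\<^esub> h)"
    proof (intro ext)
      fix l S T
      have "(\<Sum>U\<in>M l. (\<Sum>V\<in>M l. f l S V * g l V U) * h l U T) =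
          (\<Sum>V\<in>M l. f l S V * (\<Sum>U\<in>M l. g l V U * h l U T))"
        by (simp only: sum_distrib_left sum_distrib_right mult.assoc) (rule sum.swap)
      then show "(f \<otimes>\<^bsub>cell_matrices\<^esub> g \<otimes>\<^bsub>cell_matrices\<^esub> h) l S T =
          (f \<otimes>\<^bsub>cell_matrices\<^esub> (g \<otimes>\<^bsub>cell_matrices\<^esub> h)) l S T"
        by (simp add: cell_matrices_simps cong: sum.cong)
    qed
  next
    fix f assume f: "f \<in> carrier cell_matrices"
    show "\<one>\<^bsub>cell_matrices\<^esub> \<otimes>\<^bsub>cell_matrices\<^esub> f = f"
    proof (intro ext)
      fix l S T
      have "(\<Sum>U\<in>M l. \<one>\<^bsub>cell_matrices\<^esub> l S U * f l U T) = (\<Sum>U\<in>M l. if U = S then f l S T else 0)"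
        if "(l, S, T) \<in> idx"
        by (rule sum.cong) (use that in \<open>auto simp: cell_matrices_simps\<close>)
      then show "(\<one>\<^bsub>cell_matrices\<^esub> \<otimes>\<^bsub>cell_matrices\<^esub> f) l S T = f l S T"
        using f finite_M[of l] by (auto simp: cell_matrices_simps(1,2) simp del: mem_idx) auto
    qed
    show "f \<otimes>\<^bsub>cell_matrices\<^esub> \<one>\<^bsub>cell_matrices\<^esub> = f"
    proof (intro ext)
      fix l S T
      have "(\<Sum>U\<in>M l. f l S U * \<one>\<^bsub>cell_matrices\<^esub> l U T) = (\<Sum>U\<in>M l. if U = T then f l S T else 0)"
        if "(l, S, T) \<in> idx"
        by (rule sum.cong) (use that in \<open>auto simp: cell_matrices_simps\<close>)
      then show "(f \<otimes>\<^bsub>cell_matrices\<^esub> \<one>\<^bsub>cell_matrices\<^esub>) l S T = f l S T"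
        using f finite_M[of l] by (auto simp: cell_matrices_simps(1,2) simp del: mem_idx) auto
    qed
  qed (auto simp: cell_matrices_simps)
qed (auto simp: cell_matrices_simps fun_eq_iff distrib_left distrib_right sum.distrib)

definition block_scalar :: "('l \<Rightarrow> 'r fract) \<Rightarrow> 'l \<Rightarrow> 's \<Rightarrow> 's \<Rightarrow> 'r fract" where
  "block_scalar w = (\<lambda>l S T. if (l, S, T) \<in> idx \<and> S = T then w l else 0)"

lemma block_scalar_in_center: "block_scalar w \<in> ring_center cell_matrices"
  unfolding ring_center_def
proof (intro CollectI conjI ballI ext)
  show "block_scalar w \<in> carrier cell_matrices" by (auto simp: cell_matrices_simps block_scalar_def)
  fix f l S T
  have "(\<Sum>U\<in>M l. block_scalar w l S U * f l U T) = (\<Sum>U\<in>M l. if U = S then w l * f l S T else 0)"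
    "(\<Sum>U\<in>M l. f l S U * block_scalar w l U T) = (\<Sum>U\<in>M l. if U = T then w l * f l S T else 0)"
    if "(l, S, T) \<in> idx"
    by (intro sum.cong; use that in \<open>auto simp: block_scalar_def\<close>)+
  then show "(block_scalar w \<otimes>\<^bsub>cell_matrices\<^esub> f) l S T = (f \<otimes>\<^bsub>cell_matrices\<^esub> block_scalar w) l S T"
    using finite_M[of l] by (simp add: cell_matrices_simps)
qed

text \<open>
  Commuting with the matrix units forces a matrix to be scalar.
\<close>

lemma center_is_block_scalar:
  assumes "z \<in> ring_center cell_matrices"
  shows "\<exists>w. z = block_scalar w"
proof -
  have z: "z \<in> carrier cell_matrices"
    and comm: "\<And>f. f \<in> carrier cell_matrices \<Longrightarrow> z \<otimes>\<^bsub>cell_matrices\<^esub> f = f \<otimes>\<^bsub>cell_matrices\<^esub> z"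
    using assms by (auto simp: ring_center_def)
  have unit: "(if T = Q then z l S P else 0) = (if S = P then z l Q T else 0)"
    if "l \<in> \<Lambda>" "S \<in> M l" "T \<in> M l" "P \<in> M l" "Q \<in> M l" for l S T P Q
  proof -
    define E :: "'l \<Rightarrow> 's \<Rightarrow> 's \<Rightarrow> 'r fract" where
      "E = (\<lambda>l' S T. if l' = l \<and> S = P \<and> T = Q then 1 else 0)"
    have "E \<in> carrier cell_matrices" using that by (auto simp: cell_matrices_simps E_def)
    from fun_cong[OF fun_cong[OF fun_cong[OF comm[OF this], of l], of S], of T]
    have "(\<Sum>U\<in>M l. z l S U * E l U T) = (\<Sum>U\<in>M l. E l S U * z l U T)"
      using that by (simp add: cell_matrices_simps)
    also have "(\<Sum>U\<in>M l. z l S U * E l U T) = (\<Sum>U\<in>M l. if U = P then if T = Q then z l S P else 0 else 0)"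
      by (rule sum.cong) (auto simp: E_def)
    also have "(\<Sum>U\<in>M l. E l S U * z l U T) = (\<Sum>U\<in>M l. if U = Q then if S = P then z l Q T else 0 else 0)"
      by (rule sum.cong) (auto simp: E_def)
    finally show ?thesis using finite_M[OF that(1)] that by simp
  qed
  define w where "w l = (let T = SOME T. T \<in> M l in z l T T)" for l
  have "z l S T = block_scalar w l S T" for l S T
  proof (cases "(l, S, T) \<in> idx")
    case True
    then have l: "l \<in> \<Lambda>" "S \<in> M l" "T \<in> M l" by auto
    then have *: "(SOME T. T \<in> M l) \<in> M l" by (intro someI)
    have "z l S S = w l" unfolding w_def Let_def using unit[OF l(1,2) * l(2) *] by simp
    moreover have "z l S T = 0" if "S \<noteq> T" using unit[of l S T T T] l that by simp
    ultimately show ?thesis using True by (auto simp: block_scalar_def)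
  next
    case False
    then show ?thesis using z by (simp add: block_scalar_def cell_matrices_simps del: mem_idx)
  qed
  then show ?thesis by (auto simp: fun_eq_iff)
qed

text \<open>
  The entry at \<open>S, T\<close> of the matrix by which a formal sum of pairs \<open>(a, k)\<close>, standing for \<open>k\<close> times
  \<open>a\<close>, acts on the cell module of \<open>l\<close> over the field of fractions.
\<close>

definition entry :: "'l \<Rightarrow> 's \<Rightarrow> 's \<Rightarrow> (('a \<times> 'r fract) \<Rightarrow>\<^sub>0 int) \<Rightarrow> 'r fract" where
  "entry l S T f = (\<Sum>x\<in>Poly_Mapping.keys f. of_int (Poly_Mapping.lookup f x) * (snd x * emb (rep l (fst x) S T)))"

lemma entry_0: "entry l S T 0 = 0"
  by (simp add: entry_def)

lemma entry_add: "entry l S T (f + g) = entry l S T f + entry l S T g"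
  unfolding entry_def by (rule setsum_keys_plus_distrib) (auto simp: distrib_right)

lemma entry_single: "entry l S T (Poly_Mapping.single (a, k) n) = of_int n * (k * emb (rep l a S T))"
  by (simp add: entry_def)

lemma entry_uminus: "entry l S T (- f) = - entry l S T f"
  using entry_add[of l S T f "- f"] by (simp add: entry_0 eq_neg_iff_add_eq_0 add.commute)

lemma entry_diff: "entry l S T (f - g) = entry l S T f - entry l S T g"
  using entry_add[of l S T f "- g"] by (simp add: entry_uminus)

lemma entry_sum: "entry l S T (\<Sum>x\<in>X. f x) = (\<Sum>x\<in>X. entry l S T (f x))"
  by (induction X rule: infinite_finite_induct) (auto simp: entry_0 entry_add)

lemma entry_mult:
  assumes "(l, S, T) \<in> idx"
  shows "entry l S T (pair_mult f g) = (\<Sum>U\<in>M l. entry l S U f * entry l U T g)"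
proof (induction f rule: poly_mapping_additive_induct)
  case (single x u)
  show ?case
  proof (induction g rule: poly_mapping_additive_induct)
    case (single y v)
    show ?case
      using assms by (cases x, cases y)
        (simp add: pair_mult_single entry_single rep_mult emb_sum emb_mult sum_distrib_left sum_distrib_right mult_ac)
  qed (simp_all add: pair_mult_0 pair_mult_add_right entry_0 entry_add distrib_left sum.distrib)
qed (simp_all add: pair_mult_0 pair_mult_add_left entry_0 entry_add distrib_right sum.distrib)

definition matrix_of :: "(('a \<times> 'r fract) \<Rightarrow>\<^sub>0 int) \<Rightarrow> 'l \<Rightarrow> 's \<Rightarrow> 's \<Rightarrow> 'r fract" where
  "matrix_of f = (\<lambda>l S T. if (l, S, T) \<in> idx then entry l S T f else 0)"

lemma matrix_of_ring_hom: "ring_hom_ring pair_ring cell_matrices matrix_of"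
proof (rule ring_hom_ringI[OF ring_pair_ring ring_cell_matrices])
  show "matrix_of f \<in> carrier cell_matrices" for f
    by (simp add: matrix_of_def cell_matrices_simps)
  show "matrix_of (pair_mult f g) = matrix_of f \<otimes>\<^bsub>cell_matrices\<^esub> matrix_of g" for f g
  proof (intro ext)
    fix l S T
    show "matrix_of (pair_mult f g) l S T = (matrix_of f \<otimes>\<^bsub>cell_matrices\<^esub> matrix_of g) l S T"
      using entry_mult[of l S T f g] by (simp add: matrix_of_def cell_matrices_simps)
  qed
  show "matrix_of (f \<oplus>\<^bsub>pair_ring\<^esub> g) = matrix_of f \<oplus>\<^bsub>cell_matrices\<^esub> matrix_of g" for f g
    by (auto simp: fun_eq_iff matrix_of_def cell_matrices_simps pair_ring_simps entry_add)
  show "matrix_of \<one>\<^bsub>pair_ring\<^esub> = \<one>\<^bsub>cell_matrices\<^esub>"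
    by (auto simp: fun_eq_iff matrix_of_def cell_matrices_simps pair_ring_simps entry_single rep_1 emb_0 emb_1)
qed

lemma entry_tensor_relations:
  assumes "f \<in> tensor_relations scale" "(l, S, T) \<in> idx"
  shows "entry l S T f = 0"
  using assms
  by (auto simp: tensor_relations_def entry_diff entry_single rep_add rep_scale emb_add emb_mult
      emb_def[symmetric] distrib_left distrib_right)

lemma entry_tensor_kernel:
  assumes "f \<in> tensor_kernel scale" "(l, S, T) \<in> idx"
  shows "entry l S T f = 0"
  using assms(1) unfolding tensor_kernel_def
proof (induction rule: generate.induct)
  case (inv h)
  then show ?case using entry_tensor_relations[OF _ assms(2)] by (simp only: pair_ring_a_inv entry_uminus) simp
qed (use entry_tensor_relations assms(2) in \<open>simp_all add: pair_ring_simps entry_0 entry_add\<close>)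

text \<open>
  The basis of the algebra spans the extended algebra over the field of fractions.
\<close>

lemma tensor_normal_form: "\<exists>k. f \<sim> (\<Sum>(l, S, T)\<in>idx. frag_of (C l S T, k l S T))"
proof (induction f rule: poly_mapping_additive_induct)
  case zero
  have "(\<Sum>(l, S, T)\<in>idx. frag_of (C l S T, 0)) \<sim> (\<Sum>x\<in>idx. 0)"
    by (rule tensor_cong_sum) (auto intro: tensor_cong_zero)
  then show ?case by (intro exI[of _ "\<lambda>l S T. 0"]) (auto intro: tensor_cong_sym)
next
  case (single x n)
  obtain a k where x: "x = (a, k)" by fastforce
  define h where "h = of_int n * k"
  have "Poly_Mapping.single x n \<sim> frag_of (a, h)" unfolding x h_def by (rule tensor_cong_single)
  also have "frag_of (a, h) \<sim> (\<Sum>(l, S, T)\<in>idx. frag_of (C l S T, emb (coord a l S T) * h))"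
    using tensor_cong_lincomb[of "\<lambda>(l, S, T). coord a l S T" "\<lambda>(l, S, T). C l S T" idx h] coord_expand[of a]
    by (simp add: case_prod_unfold)
  finally show ?case by (intro exI[of _ "\<lambda>l S T. emb (coord a l S T) * h"])
next
  case (add f g)
  then obtain k h where kh: "f \<sim> (\<Sum>(l, S, T)\<in>idx. frag_of (C l S T, k l S T))"
    "g \<sim> (\<Sum>(l, S, T)\<in>idx. frag_of (C l S T, h l S T))" by blast
  have "f + g \<sim> (\<Sum>x\<in>idx. case x of (l, S, T) \<Rightarrow> frag_of (C l S T, k l S T) + frag_of (C l S T, h l S T))"
    using tensor_cong_add[OF kh] by (simp add: sum.distrib case_prod_unfold)
  also have "\<dots> \<sim> (\<Sum>(l, S, T)\<in>idx. frag_of (C l S T, k l S T + h l S T))"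
    by (rule tensor_cong_sum) (auto intro: tensor_cong_sym[OF tensor_cong_relations(2)])
  finally show ?case by (intro exI[of _ "\<lambda>l S T. k l S T + h l S T"])
qed

end

section \<open>The extended algebra is a product of matrix algebras\<close>

context jucys_murphy
begin

text \<open>
  Products of triangular matrices are triangular and their diagonals multiply; this carries the
  contents from the Jucys-Murphy elements to the monomials in them.
\<close>

definition content_triangular :: "'l \<Rightarrow> 'a \<Rightarrow> ('s \<Rightarrow> 'r) \<Rightarrow> bool" where
  "content_triangular l a d \<longleftrightarrow> (\<forall>T\<in>M l. rep l a T T = d T) \<and>
     (\<forall>S\<in>M l. \<forall>T\<in>M l. S \<noteq> T \<and> rep l a S T \<noteq> 0 \<longrightarrow> (S, T) \<in> leM l)"

lemma content_triangular_1: "l \<in> \<Lambda> \<Longrightarrow> content_triangular l 1 (\<lambda>_. 1)"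
  by (simp add: content_triangular_def rep_1)

lemma content_triangular_mult:
  assumes l: "l \<in> \<Lambda>" and a: "content_triangular l a d" and b: "content_triangular l b d'"
  shows "content_triangular l (a * b) (\<lambda>T. d T * d' T)"
  unfolding content_triangular_def
proof (intro conjI ballI impI)
  have po: "trans (leM l)" "antisym (leM l)" "refl_on (M l) (leM l)"
    using order_M[OF l] by (auto simp: partial_order_on_def preorder_on_def)
  have le: "(S, T) \<in> leM l" if "S \<in> M l" "T \<in> M l" "rep l x S T \<noteq> 0" "content_triangular l x e" for S T x e
    using that po(3) by (cases "S = T") (auto simp: content_triangular_def dest: refl_onD)
  fix T assume T: "T \<in> M l"
  have "rep l (a * b) T T = (\<Sum>U\<in>M l. if U = T then d T * d' T else 0)"
    unfolding rep_mult[OF l T T]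
  proof (rule sum.cong[OF refl])
    fix U assume U: "U \<in> M l"
    have "rep l a T U = 0 \<or> rep l b U T = 0" if "U \<noteq> T"
      using le[OF T U _ a] le[OF U T _ b] that antisymD[OF po(2)] by blast
    then show "rep l a T U * rep l b U T = (if U = T then d T * d' T else 0)"
      using a b T by (auto simp: content_triangular_def)
  qed
  then show "rep l (a * b) T T = d T * d' T" using T finite_M[OF l] by simp
  fix S assume S: "S \<in> M l" and "S \<noteq> T \<and> rep l (a * b) S T \<noteq> 0"
  then obtain U where "U \<in> M l" "rep l a S U * rep l b U T \<noteq> 0"
    unfolding rep_mult[OF l S T] by (auto elim!: sum.not_neutral_contains_not_neutral)
  then show "(S, T) \<in> leM l" using le[OF S _ _ a] le[OF _ T _ b] transD[OF po(1)] by (metis mult_eq_0_iff)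
qed

lemma content_triangular_power:
  "l \<in> \<Lambda> \<Longrightarrow> content_triangular l a d \<Longrightarrow> content_triangular l (a ^ n) (\<lambda>T. d T ^ n)"
  by (induction n) (auto simp: content_triangular_1 intro: content_triangular_mult)

lemma content_triangular_prod_list:
  "l \<in> \<Lambda> \<Longrightarrow> (\<And>i. i \<in> set is \<Longrightarrow> content_triangular l (a i) (d i)) \<Longrightarrow>
    content_triangular l (\<Prod>i\<leftarrow>is. a i) (\<lambda>T. \<Prod>i\<leftarrow>is. d i T)"
  by (induction "is") (auto simp: content_triangular_1 intro: content_triangular_mult)

lemma rep_monomial_diagonal:
  assumes "l \<in> \<Lambda>" "T \<in> M l"
  shows "rep l (monomial_at m L e) T T = (\<Prod>i\<in>{1..m}. c l T i ^ Poly_Mapping.lookup e i)"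
proof -
  have "content_triangular l (L i) (\<lambda>T. c l T i)" if "i \<in> {1..m}" for i
    using rep_JM[OF assms(1) that] by (auto simp: content_triangular_def)
  then have "content_triangular l (monomial_at m L e)
      (\<lambda>T. \<Prod>i\<leftarrow>[1..<Suc m]. c l T i ^ Poly_Mapping.lookup e i)"
    unfolding monomial_at_def
    by (intro content_triangular_prod_list content_triangular_power assms) auto
  then show ?thesis
    using assms(2) prod.distinct_set_conv_list[of "[1..<Suc m]" "\<lambda>i. c l T i ^ Poly_Mapping.lookup e i"]
    by (simp add: content_triangular_def atLeastLessThanSuc_atLeastAtMost del: upt_Suc)
qed

context
  assumes sep: "separation_condition \<Lambda> leL M leM m c"
begin

text \<open>
  A linear relation over the field of fractions becomes one over the domain after multiplication
  with a common denominator.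
\<close>

lemma rep_faithful_fractions:
  fixes k :: "'l \<times> 's \<times> 's \<Rightarrow> 'r fract"
  assumes "\<And>l S T. (l, S, T) \<in> idx \<Longrightarrow> (\<Sum>(u, P, Q)\<in>idx. emb (rep l (C u P Q) S T) * k (u, P, Q)) = 0"
    and "b \<in> idx"
  shows "k b = 0"
proof -
  obtain d x where d: "d \<noteq> 0" "\<And>b. b \<in> idx \<Longrightarrow> emb d * k b = emb (x b)"
    using common_denominator[OF finite_idx, of k] by blast
  define a where "a = (\<Sum>(u, P, Q)\<in>idx. x (u, P, Q) *s C u P Q)"
  have "a = 0"
  proof (rule rep_faithful[OF sep])
    fix l S T assume lST: "(l, S, T) \<in> idx"
    have "emb (rep l a S T) = (\<Sum>(u, P, Q)\<in>idx. emb (x (u, P, Q)) * emb (rep l (C u P Q) S T))"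
      using lST by (simp add: a_def rep_sum rep_scale emb_sum emb_mult case_prod_unfold)
    also have "\<dots> = (\<Sum>(u, P, Q)\<in>idx. emb d * (emb (rep l (C u P Q) S T) * k (u, P, Q)))"
      by (rule sum.cong) (auto simp: d(2)[symmetric] mult_ac)
    also have "\<dots> = emb d * (\<Sum>(u, P, Q)\<in>idx. emb (rep l (C u P Q) S T) * k (u, P, Q))"
      by (simp add: sum_distrib_left case_prod_unfold)
    finally show "rep l a S T = 0" using assms(1)[OF lST] by (metis emb_0 emb_eq_iff mult_zero_right)
  qed
  moreover obtain u P Q where b: "b = (u, P, Q)" by (cases b)
  ultimately have "x b = 0"
    using coord_lincomb[of u P Q "\<lambda>u P Q. x (u, P, Q)"] assms(2) by (simp add: a_def coord_0)
  then have "emb d * k b = 0" using d(2)[OF assms(2)] by (simp add: emb_0)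
  moreover have "emb d \<noteq> 0" using d(1) emb_eq_iff[of d 0] by (simp add: emb_0)
  ultimately show ?thesis by simp
qed

lemma entry_lincomb:
  "entry l S T (\<Sum>(u, P, Q)\<in>idx. frag_of (C u P Q, k (u, P, Q))) =
    (\<Sum>(u, P, Q)\<in>idx. emb (rep l (C u P Q) S T) * k (u, P, Q))"
  by (simp add: entry_sum entry_single case_prod_unfold mult.commute)

text \<open>
  The tensor relations hold for matrices. Conversely, modulo these relations a formal sum is a
  combination of basis elements, whose coefficients vanish by faithfulness if its matrix does.
  Thus the tensor product is the quotient by the kernel of a ring homomorphism.
\<close>

lemma matrix_of_kernel: "a_kernel pair_ring cell_matrices matrix_of = tensor_kernel scale"
proof (intro equalityI subsetI)
  fix f assume "f \<in> tensor_kernel scale"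
  then show "f \<in> a_kernel pair_ring cell_matrices matrix_of"
    using entry_tensor_kernel[of f] by (auto simp: a_kernel_def' pair_ring_simps fun_eq_iff cell_matrices_simps matrix_of_def)
next
  fix f assume "f \<in> a_kernel pair_ring cell_matrices matrix_of"
  then have "matrix_of f = \<zero>\<^bsub>cell_matrices\<^esub>" by (simp add: a_kernel_def')
  then have "matrix_of f l S T = 0" for l S T by (simp add: cell_matrices_simps)
  then have f: "entry l S T f = 0" if "(l, S, T) \<in> idx" for l S T
    using that unfolding matrix_of_def by metis
  obtain k where "f \<sim> (\<Sum>(l, S, T)\<in>idx. frag_of (C l S T, k l S T))"
    using tensor_normal_form by blast
  then have k: "f \<sim> (\<Sum>(l, S, T)\<in>idx. frag_of (C l S T, (\<lambda>(l, S, T). k l S T) (l, S, T)))" by simp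
  have k0: "(\<lambda>(l, S, T). k l S T) b = 0" if "b \<in> idx" for b
  proof (rule rep_faithful_fractions[OF _ that])
    fix l S T assume lST: "(l, S, T) \<in> idx"
    have "entry l S T (f - (\<Sum>(l, S, T)\<in>idx. frag_of (C l S T, (\<lambda>(l, S, T). k l S T) (l, S, T)))) = 0"
      using k lST unfolding tensor_cong_def by (rule entry_tensor_kernel)
    then show "(\<Sum>(u, P, Q)\<in>idx. emb (rep l (C u P Q) S T) * (\<lambda>(l, S, T). k l S T) (u, P, Q)) = 0"
      unfolding entry_diff entry_lincomb using f[OF lST] by simp
  qed
  note k
  also have "(\<Sum>(l, S, T)\<in>idx. frag_of (C l S T, (\<lambda>(l, S, T). k l S T) (l, S, T))) \<sim> (\<Sum>x\<in>idx. 0)"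
    by (rule tensor_cong_sum) (use k0 in \<open>force intro: tensor_cong_zero\<close>)
  finally show "f \<in> tensor_kernel scale" by (simp add: tensor_cong_def)
qed

text \<open>
  The basis and the matrix entries have the same index set, so the action of the extended algebra
  on all cell modules is given by a square matrix.
\<close>

lemma matrix_of_surj: "matrix_of ` carrier pair_ring = carrier cell_matrices"
proof (intro equalityI subsetI)
  fix F assume "F \<in> matrix_of ` carrier pair_ring"
  then show "F \<in> carrier cell_matrices" by (auto simp: matrix_of_def cell_matrices_simps)
next
  fix F assume F: "F \<in> carrier cell_matrices"
  have "\<exists>k. \<forall>i\<in>idx. (\<Sum>j\<in>idx. (\<lambda>(l, S, T) (u, P, Q). emb (rep l (C u P Q) S T)) i j * k j) =
      (\<lambda>(l, S, T). F l S T) i"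
  proof (rule injective_square_surjective[OF finite_idx])
    fix v j
    assume "\<And>i. i \<in> idx \<Longrightarrow> (\<Sum>j\<in>idx. (\<lambda>(l, S, T) (u, P, Q). emb (rep l (C u P Q) S T)) i j * v j) = 0"
      and j: "j \<in> idx"
    then have "(\<Sum>(u, P, Q)\<in>idx. emb (rep l (C u P Q) S T) * v (u, P, Q)) = 0" if "(l, S, T) \<in> idx" for l S T
      using that by (fastforce simp: case_prod_unfold)
    then show "v j = 0" using j by (rule rep_faithful_fractions)
  qed
  then obtain k where k: "\<And>l S T. (l, S, T) \<in> idx \<Longrightarrow>
      (\<Sum>(u, P, Q)\<in>idx. emb (rep l (C u P Q) S T) * k (u, P, Q)) = F l S T"
    by (fastforce simp: case_prod_unfold)
  have "F = matrix_of (\<Sum>(u, P, Q)\<in>idx. frag_of (C u P Q, k (u, P, Q)))"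
    using F by (simp only: fun_eq_iff matrix_of_def entry_lincomb cell_matrices_simps(1)) (use k in auto)
  then show "F \<in> matrix_of ` carrier pair_ring" by (simp add: pair_ring_simps)
qed

definition wedderburn :: "(('a \<times> 'r fract) \<Rightarrow>\<^sub>0 int) set \<Rightarrow> 'l \<Rightarrow> 's \<Rightarrow> 's \<Rightarrow> 'r fract" where
  "wedderburn X = the_elem (matrix_of ` X)"

lemma wedderburn_iso: "wedderburn \<in> ring_iso (scalar_ext scale) cell_matrices"
  using ring_hom_ring.FactRing_iso_set[OF matrix_of_ring_hom matrix_of_surj]
  unfolding wedderburn_def scalar_ext_def matrix_of_kernel by simp

lemma wedderburn_tensor:
  "wedderburn (tensor scale a k) = (\<lambda>l S T. if (l, S, T) \<in> idx then k * emb (rep l a S T) else 0)"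
  unfolding wedderburn_def tensor_def
  using ring_hom_ring.the_elem_simp[OF matrix_of_ring_hom, of "frag_of (a, k)"]
  by (simp add: matrix_of_kernel pair_ring_simps matrix_of_def entry_single fun_eq_iff)

lemma ring_scalar_ext: "ring (scalar_ext scale)"
  using ideal.quotient_is_ring[OF ring_hom_ring.kernel_is_ideal[OF matrix_of_ring_hom]]
  unfolding scalar_ext_def matrix_of_kernel .

lemma tensor_closed: "tensor scale a k \<in> carrier (scalar_ext scale)"
  unfolding scalar_ext_def tensor_def FactRing_def A_RCOSETS_def' by (auto simp: pair_ring_simps)

lemma wedderburn_finsum:
  assumes "\<And>e. e \<in> X \<Longrightarrow> f e \<in> carrier (scalar_ext scale)" "finite X"
  shows "wedderburn (\<Oplus>\<^bsub>scalar_ext scale\<^esub>e\<in>X. f e) l S T = (\<Sum>e\<in>X. wedderburn (f e) l S T)"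
  using assms(2,1)
proof (induction X rule: finite_induct)
  interpret ring "scalar_ext scale" by (rule ring_scalar_ext)
  case empty
  have "wedderburn \<zero>\<^bsub>scalar_ext scale\<^esub> = \<zero>\<^bsub>cell_matrices\<^esub>"
    using ring_hom_zero[of wedderburn] wedderburn_iso ring_scalar_ext ring_cell_matrices
    by (auto simp: ring_iso_def)
  then show ?case by (simp add: cell_matrices_simps)
next
  interpret ring "scalar_ext scale" by (rule ring_scalar_ext)
  case (insert e X)
  have "wedderburn (f e \<oplus>\<^bsub>scalar_ext scale\<^esub> (\<Oplus>\<^bsub>scalar_ext scale\<^esub>e\<in>X. f e)) =
      wedderburn (f e) \<oplus>\<^bsub>cell_matrices\<^esub> wedderburn (\<Oplus>\<^bsub>scalar_ext scale\<^esub>e\<in>X. f e)"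
    using insert by (intro ring_iso_memE(3)[OF wedderburn_iso] finsum_closed) auto
  then show ?case using insert by (simp add: finsum_insert Pi_def cell_matrices_simps)
qed

lemma poly_at_closed: "poly_at scale m L p \<in> carrier (scalar_ext scale)"
proof -
  interpret ring "scalar_ext scale" by (rule ring_scalar_ext)
  show ?thesis unfolding poly_at_def by (rule finsum_closed) (auto simp: tensor_closed)
qed

lemma wedderburn_poly_diagonal:
  assumes "l \<in> \<Lambda>" "T \<in> M l"
  shows "wedderburn (poly_at scale m L p) l T T = poly_eval m (\<lambda>i. emb (c l T i)) p"
  using assms
  by (simp add: poly_at_def wedderburn_finsum tensor_closed wedderburn_tensor rep_monomial_diagonal
      poly_eval_def emb_prod emb_power)

lemma ring_center_iff:
  assumes "z \<in> carrier (scalar_ext scale)"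
  shows "z \<in> ring_center (scalar_ext scale) \<longleftrightarrow> (\<exists>w. wedderburn z = block_scalar w)"
proof -
  note iso = ring_iso_memE[OF wedderburn_iso]
  have inj: "inj_on wedderburn (carrier (scalar_ext scale))"
    and surj: "wedderburn ` carrier (scalar_ext scale) = carrier cell_matrices"
    using iso(5) by (auto simp: bij_betw_def)
  have "z \<in> ring_center (scalar_ext scale) \<longleftrightarrow> wedderburn z \<in> ring_center cell_matrices"
  proof
    assume z: "z \<in> ring_center (scalar_ext scale)"
    show "wedderburn z \<in> ring_center cell_matrices"
      unfolding ring_center_def
    proof (intro CollectI conjI ballI)
      fix f assume "f \<in> carrier cell_matrices"
      then obtain x where x: "x \<in> carrier (scalar_ext scale)" "f = wedderburn x"
        unfolding surj[symmetric] by (rule imageE)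
      then show "wedderburn z \<otimes>\<^bsub>cell_matrices\<^esub> f = f \<otimes>\<^bsub>cell_matrices\<^esub> wedderburn z"
        using iso(2)[OF assms x(1)] iso(2)[OF x(1) assms] z by (simp add: ring_center_def)
    qed (use iso(1) assms in auto)
  next
    assume z: "wedderburn z \<in> ring_center cell_matrices"
    show "z \<in> ring_center (scalar_ext scale)"
      unfolding ring_center_def
    proof (intro CollectI conjI ballI assms)
      fix x assume x: "x \<in> carrier (scalar_ext scale)"
      have "wedderburn (z \<otimes>\<^bsub>scalar_ext scale\<^esub> x) = wedderburn (x \<otimes>\<^bsub>scalar_ext scale\<^esub> z)"
        using iso(2)[OF assms x] iso(2)[OF x assms] z iso(1)[OF x] by (simp add: ring_center_def)
      then show "z \<otimes>\<^bsub>scalar_ext scale\<^esub> x = x \<otimes>\<^bsub>scalar_ext scale\<^esub> z"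
        by (rule inj_onD[OF inj])
          (use monoid.m_closed[OF ring.is_monoid[OF ring_scalar_ext]] assms x in simp_all)
    qed
  qed
  also have "\<dots> \<longleftrightarrow> (\<exists>w. wedderburn z = block_scalar w)"
    by (auto dest: center_is_block_scalar intro: block_scalar_in_center)
  finally show ?thesis .
qed

text \<open>
  A central element is scalar on each cell, so a single diagonal entry, here the one at \<open>t l\<close>,
  determines it; for a polynomial this entry is the value at the content vector of \<open>t l\<close>.
\<close>

lemma wedderburn_central_poly:
  assumes "\<forall>l\<in>\<Lambda>. t l \<in> M l" "poly_at scale m L p \<in> ring_center (scalar_ext scale)"
  shows "wedderburn (poly_at scale m L p) = block_scalar (\<lambda>l. poly_eval m (\<lambda>i. emb (c l (t l) i)) p)"
proof -
  obtain w where w: "wedderburn (poly_at scale m L p) = block_scalar w"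
    using assms(2) ring_center_iff[OF poly_at_closed] by blast
  have "w l = poly_eval m (\<lambda>i. emb (c l (t l) i)) p" if "l \<in> \<Lambda>" for l
    using wedderburn_poly_diagonal[of l "t l" p] that assms(1) by (simp add: w block_scalar_def)
  then show ?thesis unfolding w by (auto simp: block_scalar_def fun_eq_iff)
qed

end

end

theorem theorem3p3:
  fixes scale :: "'r::idom \<Rightarrow> 'a::{ring,monoid_mult} \<Rightarrow> 'a"
    and \<Lambda> :: "'l set" and leL :: "'l rel"
    and M :: "'l \<Rightarrow> 's set" and leM :: "'l \<Rightarrow> 's rel"
    and C :: "'l \<Rightarrow> 's \<Rightarrow> 's \<Rightarrow> 'a" and \<iota> :: "'a \<Rightarrow> 'a"
    and m :: nat and L :: "nat \<Rightarrow> 'a" and c :: "'l \<Rightarrow> 's \<Rightarrow> nat \<Rightarrow> 'r"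
    and t :: "'l \<Rightarrow> 's"
  assumes "jucys_murphy scale \<Lambda> leL M leM C \<iota> m L c"
    and "separation_condition \<Lambda> leL M leM m c"
    and "\<forall>p\<in>symmetric_polys m. poly_at scale m L p \<in> ring_center (scalar_ext scale)"
    and "\<forall>l\<in>\<Lambda>. t l \<in> M l"
  shows "ring_center (scalar_ext scale) = {poly_at scale m L p | p. p \<in> symmetric_polys m} \<longleftrightarrow>
    (\<forall>l\<in>\<Lambda>. \<forall>l'\<in>\<Lambda>. l \<noteq> l' \<longrightarrow>
       \<not> (\<exists>\<sigma>. \<sigma> permutes {1..m} \<and> (\<forall>i\<in>{1..m}. c l (t l) i = c l' (t l') (\<sigma> i))))"
proof -
  interpret jucys_murphy scale \<Lambda> leL M leM C \<iota> m L c by (rule assms(1))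
  define \<Theta> where "\<Theta> = wedderburn"
  define x where "x l i = emb (c l (t l) i)" for l i
  note iso = ring_iso_memE[OF wedderburn_iso[OF assms(2)], folded \<Theta>_def]
  note center = ring_center_iff[OF assms(2), folded \<Theta>_def]
  have inj: "inj_on \<Theta> (carrier (scalar_ext scale))"
    and surj: "\<Theta> ` carrier (scalar_ext scale) = carrier cell_matrices"
    using iso(5) by (auto simp: bij_betw_def)
  have poly: "\<Theta> (poly_at scale m L p) = block_scalar (\<lambda>l. poly_eval m (x l) p)" if "p \<in> symmetric_polys m" for p
    using wedderburn_central_poly[OF assms(2,4)] assms(3) that by (simp add: \<Theta>_def x_def[abs_def])
  have sub: "{poly_at scale m L p | p. p \<in> symmetric_polys m} \<subseteq> ring_center (scalar_ext scale)"
    using assms(3) by blast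
  have scalar_eq: "w l = w' l" if "block_scalar w = block_scalar w'" "l \<in> \<Lambda>" for w w' l
    using fun_cong[OF fun_cong[OF fun_cong[OF that(1), of l], of "t l"], of "t l"] that(2) assms(4)
    by (simp add: block_scalar_def)
  show ?thesis
  proof
    assume eq: "ring_center (scalar_ext scale) = {poly_at scale m L p | p. p \<in> symmetric_polys m}"
    show "\<forall>l\<in>\<Lambda>. \<forall>l'\<in>\<Lambda>. l \<noteq> l' \<longrightarrow>
       \<not> (\<exists>\<sigma>. \<sigma> permutes {1..m} \<and> (\<forall>i\<in>{1..m}. c l (t l) i = c l' (t l') (\<sigma> i)))"
    proof (intro ballI impI notI)
      fix l l' assume l: "l \<in> \<Lambda>" "l' \<in> \<Lambda>" "l \<noteq> l'"
      assume "\<exists>\<sigma>. \<sigma> permutes {1..m} \<and> (\<forall>i\<in>{1..m}. c l (t l) i = c l' (t l') (\<sigma> i))"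
      then obtain \<sigma> where \<sigma>: "\<sigma> permutes {1..m}" "\<forall>i\<in>{1..m}. x l i = x l' (\<sigma> i)"
        unfolding x_def by metis
      \<comment> \<open>The central idempotent of \<open>l\<close> is \<open>1\<close> on \<open>l\<close> and \<open>0\<close> on \<open>l'\<close>, where symmetric polynomials agree.\<close>
      let ?d = "\<lambda>u. if u = l then 1 else 0"
      have "block_scalar ?d \<in> carrier cell_matrices"
        using block_scalar_in_center by (auto simp: ring_center_def)
      then obtain z where z: "z \<in> carrier (scalar_ext scale)" "\<Theta> z = block_scalar ?d"
        unfolding surj[symmetric] by (elim imageE) simp
      then obtain p where p: "p \<in> symmetric_polys m" "z = poly_at scale m L p"
        using center[OF z(1)] eq by blast
      then have "block_scalar ?d = block_scalar (\<lambda>l. poly_eval m (x l) p)" using poly z(2) by metis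
      from scalar_eq[OF this l(1)] scalar_eq[OF this l(2)]
      have "poly_eval m (x l) p \<noteq> poly_eval m (x l') p" using l(3) by simp
      then show False using poly_eval_symmetric_permute[OF p(1) \<sigma>] by simp
    qed
  next
    assume distinct: "\<forall>l\<in>\<Lambda>. \<forall>l'\<in>\<Lambda>. l \<noteq> l' \<longrightarrow>
       \<not> (\<exists>\<sigma>. \<sigma> permutes {1..m} \<and> (\<forall>i\<in>{1..m}. c l (t l) i = c l' (t l') (\<sigma> i)))"
    have "z \<in> {poly_at scale m L p | p. p \<in> symmetric_polys m}" if z: "z \<in> ring_center (scalar_ext scale)" for z
    proof -
      have zc: "z \<in> carrier (scalar_ext scale)" using z by (simp add: ring_center_def)
      obtain w where w: "\<Theta> z = block_scalar w" using center[OF zc] z by blast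
      have no_perm: "\<not> (\<exists>\<sigma>. \<sigma> permutes {1..m} \<and> (\<forall>i\<in>{1..m}. x l i = x l' (\<sigma> i)))"
        if "l \<in> \<Lambda>" "l' \<in> \<Lambda>" "l \<noteq> l'" for l l'
        using distinct that by (simp only: x_def emb_eq_iff) blast
      obtain p where p: "p \<in> symmetric_polys m" "\<forall>l\<in>\<Lambda>. poly_eval m (x l) p = w l"
        using symmetric_interpolation[where x = x and w = w and m = m, OF finite_Lambda no_perm]
        by blast
      have "\<Theta> (poly_at scale m L p) = \<Theta> z"
        unfolding poly[OF p(1)] w using p(2) by (auto simp: block_scalar_def fun_eq_iff)
      then have "poly_at scale m L p = z"
        using inj_onD[OF inj] zc poly_at_closed[OF assms(2)] by blast
      then show ?thesis using p(1) by blast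
    qed
    then show "ring_center (scalar_ext scale) = {poly_at scale m L p | p. p \<in> symmetric_polys m}"
      using sub by blast
  qed
qed

end
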